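(* Let $q\ge 3$ be a prime power and let $X\subset\mathbb{P}^3(\mathbb{F}_q)$ be an elliptic quadric. The minimum weight codewords of $C_2(X)$ correspond to the quadrics of the following types, i.e. a codeword of $C_2(X)$ has minimum weight if and only if it equals $c(f)$ for some form $f$ of degree 2 such that $Z(f)$ is one of the following: (1) a union of two distinct non-tangent planes to $X$ such that the line of intersection of the two planes is skew to $X$; (2) a quadric cone whose vertex does not lie on $X$ and all of whose $q+1$ lines are bisecants to $X$; (3) a hyperbolic quadric such that all the $q+1$ lines of one of its reguli are bisecants to $X$.
   Context: A quadric in $\mathbb{P}^3(\mathbb{F}_q)$ is the zero set $Z(f)$ of a nonzero form $f$ of degree 2 in $x_0,\dots,x_3$ over $\mathbb{F}_q$; its rank is the smallest number of indeterminates appearing in $f$ under any linear change of coordinates, and it is non-degenerate if its rank is 4. An elliptic quadric is a non-degenerate quadric with $q^2+1$ points over $\mathbb{F}_q$; a hyperbolic quadric is a non-degenerate quadric with $(q+1)^2$ points over $\mathbb{F}_q$. A quadric cone is a quadric of rank 3; it consists of $q+1$ lines through a common point, its vertex. A regulus is the set of transversals of three pairwise skew lines in $\mathbb{P}^3(\mathbb{F}_q)$; it consists of $q+1$ pairwise skew lines, and a hyperbolic quadric is a pair of complementary reguli, each of which covers it. A line is skew to $X$ if it contains no $\mathbb{F}_q$-point of $X$, and a bisecant to $X$ if it meets $X$ in exactly two points. A plane is non-tangent to $X$ if it meets $X$ in a (non-degenerate) conic, and tangent otherwise (it then meets the elliptic quadric in a single point). Let $F$ be the $\mathbb{F}_q$-vector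 space of forms of degree 2 in $x_0,\dots,x_3$ over $\mathbb{F}_q$ (including $0$). Each point $x\in\mathbb{P}^3(\mathbb{F}_q)$ is represented by its unique homogeneous coordinate vector whose first nonzero coordinate equals $1$. The functional code $C_2(X)$ is the image of the linear map $c:F\to\mathbb{F}_q^{|X|}$, $c(f)=(f(x_0,\dots,x_3))_{x\in X}$. The weight of a codeword is its number of nonzero coordinates; the minimum weight is the smallest nonzero weight. *)

theory Defs
  imports "HOL-Analysis.Cartesian_Space" "HOL-Library.Poly_Mapping"
begin

text \<open>
  Polynomials in indeterminates indexed by a finite type \<open>'n\<close> are finitely supported families of
  coefficients indexed by monomials \<open>'n \<Rightarrow>\<^sub>0 nat\<close>. The indeterminates \<open>x\<^sub>0, ..., x\<^sub>3\<close> are indexed by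
  the elements \<open>0 < 1 < 2 < 3\<close> of the numeral type \<open>4\<close>.
\<close>

type_synonym ('a, 'n) mpoly = "('n \<Rightarrow>\<^sub>0 nat) \<Rightarrow>\<^sub>0 'a"

definition poly_eval :: "('a::comm_ring_1, 'n::finite) mpoly \<Rightarrow> 'a ^ 'n \<Rightarrow> 'a" where
  "poly_eval f x =
     (\<Sum>m\<in>Poly_Mapping.keys f. Poly_Mapping.lookup f m * (\<Prod>i\<in>UNIV. (x $ i) ^ Poly_Mapping.lookup m i))"

definition quadratic_forms :: "('a::comm_ring_1, 'n::finite) mpoly set" where
  "quadratic_forms = {f. \<forall>m\<in>Poly_Mapping.keys f. (\<Sum>i\<in>UNIV. Poly_Mapping.lookup m i) = 2}"

definition indets :: "('a::zero, 'n) mpoly \<Rightarrow> 'n set" where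
  "indets f = (\<Union>m\<in>Poly_Mapping.keys f. Poly_Mapping.keys m)"

text \<open>The formal substitution \<open>x\<^sub>i \<mapsto> \<Sum>\<^sub>j A\<^sub>i\<^sub>j x\<^sub>j\<close>.\<close>

definition lin_subst :: "'a ^ 'm ^ 'n \<Rightarrow> ('a::comm_ring_1, 'n::finite) mpoly \<Rightarrow> ('a, 'm::finite) mpoly" where
  "lin_subst A f =
     (\<Sum>m\<in>Poly_Mapping.keys f. Poly_Mapping.single 0 (Poly_Mapping.lookup f m) *
        (\<Prod>i\<in>UNIV. (\<Sum>j\<in>UNIV. Poly_Mapping.single (Poly_Mapping.single j 1) (A $ i $ j))
                   ^ Poly_Mapping.lookup m i))"

definition form_rank :: "('a::field, 'n::finite) mpoly \<Rightarrow> nat" where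
  "form_rank f = (LEAST r. \<exists>A :: 'a ^ 'n ^ 'n. invertible A \<and> card (indets (lin_subst A f)) = r)"

text \<open>Projective points are identified with their normalized coordinate vectors; lines and planes
  are sets of such points.\<close>

definition proj_points :: "('a::field ^ 'n::{finite, linorder}) set" where
  "proj_points = {x. \<exists>i. x $ i = 1 \<and> (\<forall>j<i. x $ j = 0)}"

definition proj_lines :: "('a::field ^ 4) set set" where
  "proj_lines = {proj_points \<inter> W | W. vec.subspace W \<and> vec.dim W = 2}"

definition proj_planes :: "('a::field ^ 4) set set" where
  "proj_planes = {proj_points \<inter> W | W. vec.subspace W \<and> vec.dim W = 3}"

definition zero_set :: "('a::field, 'n::{finite, linorder}) mpoly \<Rightarrow> ('a ^ 'n::{finite, linorder}) set" where
  "zero_set f = {x \<in> proj_points. poly_eval f x = 0}"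

definition quadric_of_rank :: "nat \<Rightarrow> ('a::field ^ 'n::{finite, linorder}) set \<Rightarrow> bool" where
  "quadric_of_rank r S \<longleftrightarrow> (\<exists>f\<in>quadratic_forms. f \<noteq> 0 \<and> form_rank f = r \<and> S = zero_set f)"

definition elliptic_quadric :: "('a::{field, finite} ^ 4) set \<Rightarrow> bool" where
  "elliptic_quadric S \<longleftrightarrow> quadric_of_rank 4 S \<and> card S = CARD('a)\<^sup>2 + 1"

definition hyperbolic_quadric :: "('a::{field, finite} ^ 4) set \<Rightarrow> bool" where
  "hyperbolic_quadric S \<longleftrightarrow> quadric_of_rank 4 S \<and> card S = (CARD('a) + 1)\<^sup>2"

definition quadric_cone :: "('a::field ^ 4) set \<Rightarrow> bool" where
  "quadric_cone S \<longleftrightarrow> quadric_of_rank 3 S"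

text \<open>\<open>S\<close> consists of the \<open>q + 1\<close> lines \<open>L\<close>, all passing through \<open>v\<close>. For a quadric cone \<open>S\<close> this
  determines the vertex \<open>v\<close> and the set of lines \<open>L\<close>.\<close>

definition vertex_and_lines ::
    "('a::{field, finite} ^ 4) set \<Rightarrow> 'a ^ 4 \<Rightarrow> ('a ^ 4) set set \<Rightarrow> bool" where
  "vertex_and_lines S v L \<longleftrightarrow>
     v \<in> proj_points \<and> L \<subseteq> proj_lines \<and> card L = CARD('a) + 1 \<and> (\<forall>l\<in>L. v \<in> l) \<and> S = \<Union>L"

definition regulus :: "('a::field ^ 4) set set \<Rightarrow> bool" where
  "regulus R \<longleftrightarrow>
     (\<exists>l1\<in>proj_lines. \<exists>l2\<in>proj_lines. \<exists>l3\<in>proj_lines.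
        l1 \<inter> l2 = {} \<and> l1 \<inter> l3 = {} \<and> l2 \<inter> l3 = {} \<and>
        R = {m\<in>proj_lines. m \<inter> l1 \<noteq> {} \<and> m \<inter> l2 \<noteq> {} \<and> m \<inter> l3 \<noteq> {}})"

definition skew_to :: "('a::field ^ 4) set \<Rightarrow> ('a ^ 4) set \<Rightarrow> bool" where
  "skew_to X l \<longleftrightarrow> l \<inter> X = {}"

definition bisecant :: "('a::field ^ 4) set \<Rightarrow> ('a ^ 4) set \<Rightarrow> bool" where
  "bisecant X l \<longleftrightarrow> card (l \<inter> X) = 2"

text \<open>A conic in the plane \<open>P\<close> is the image of a rank 3 quadric of the projective plane under a
  choice \<open>A\<close> of homogeneous coordinates on \<open>P\<close>. As points are normalized vectors, it is described
  through all vectors \<open>y\<close> representing a point of the projective plane.\<close>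

definition conic_in :: "('a::field ^ 4) set \<Rightarrow> ('a ^ 4) set \<Rightarrow> bool" where
  "conic_in P C \<longleftrightarrow>
     (\<exists>(A :: 'a ^ 3 ^ 4) (g :: ('a, 3) mpoly).
        inj ((*v) A) \<and> P = proj_points \<inter> range ((*v) A) \<and>
        g \<in> quadratic_forms \<and> g \<noteq> 0 \<and> form_rank g = 3 \<and>
        C = {x \<in> proj_points. \<exists>y. x = A *v y \<and> poly_eval g y = 0})"

definition non_tangent_plane :: "('a::field ^ 4) set \<Rightarrow> ('a ^ 4) set \<Rightarrow> bool" where
  "non_tangent_plane X P \<longleftrightarrow> P \<in> proj_planes \<and> conic_in P (P \<inter> X)"

text \<open>Codewords are functions on \<open>X\<close>, extended by \<open>undefined\<close> outside \<open>X\<close>.\<close>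

definition codeword :: "('a::field ^ 4) set \<Rightarrow> ('a, 4) mpoly \<Rightarrow> 'a ^ 4 \<Rightarrow> 'a" where
  "codeword X f = restrict (poly_eval f) X"

definition functional_code :: "('a::field ^ 4) set \<Rightarrow> ('a ^ 4 \<Rightarrow> 'a) set" where
  "functional_code X = codeword X ` quadratic_forms"

definition weight :: "('a::field ^ 4) set \<Rightarrow> ('a ^ 4 \<Rightarrow> 'a) \<Rightarrow> nat" where
  "weight X w = card {x\<in>X. w x \<noteq> 0}"

definition min_weight :: "('a::field ^ 4) set \<Rightarrow> nat" where
  "min_weight X = (LEAST d. d \<noteq> 0 \<and> (\<exists>w\<in>functional_code X. weight X w = d))"

definition two_planes_type :: "('a::field ^ 4) set \<Rightarrow> ('a ^ 4) set \<Rightarrow> bool" where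
  "two_planes_type X S \<longleftrightarrow>
     (\<exists>P1 P2. non_tangent_plane X P1 \<and> non_tangent_plane X P2 \<and> P1 \<noteq> P2 \<and>
        S = P1 \<union> P2 \<and> skew_to X (P1 \<inter> P2))"

definition cone_type :: "('a::{field, finite} ^ 4) set \<Rightarrow> ('a ^ 4) set \<Rightarrow> bool" where
  "cone_type X S \<longleftrightarrow>
     quadric_cone S \<and> (\<exists>v L. vertex_and_lines S v L \<and> v \<notin> X \<and> (\<forall>l\<in>L. bisecant X l))"

text \<open>The reguli of a hyperbolic quadric are those that cover it.\<close>

definition hyperbolic_type :: "('a::{field, finite} ^ 4) set \<Rightarrow> ('a ^ 4) set \<Rightarrow> bool" where
  "hyperbolic_type X S \<longleftrightarrow>
     hyperbolic_quadric S \<and> (\<exists>R. regulus R \<and> \<Union>R = S \<and> (\<forall>l\<in>R. bisecant X l))"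

end

(*
  All zeros are counted as vectors of the four-dimensional space V over the field with q elements,
  and the basic count is that a function which is affine with nonzero slope on every line in a
  fixed direction vanishes exactly once on each of them. Applied in the directions of a totally
  singular subspace, this shows that a quadratic form on V either is a product of two linear forms
  or has at most q^3 + q^2 - q zeros.

  Let X be given by the form Q. A codeword c(f) equals c(f + t Q) for every scalar t. If no
  f + t Q is a product of linear forms, summing the bound over t yields at most 2q common points of
  X and Z(f). Otherwise f + t Q vanishes on two planes, each of which meets X in at most q + 1
  points, so there are at most 2q + 2 common points, with equality iff both planes are non-tangent
  and their line of intersection is skew to X. Hence the minimum weight is q^2 - 2q - 1 and every
  codeword of minimum weight even comes from a pair of planes; conversely each of the three types
  of quadrics meets X in 2q + 2 points, as it is covered by two planes or by q + 1 bisecants that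
  are disjoint on X.
*)
theory Submission
  imports Defs
begin

section \<open>Counting in vector spaces over finite fields\<close>

text \<open>The rank is defined formally, by indeterminates left after a substitution, while all
  counting concerns functions on V, possibly in characteristic 2. The bridge is the radical vector:
  the rank drops iff some nonzero \<open>v\<close> satisfies \<open>f (x + v) = f x\<close> for all
  \<open>x\<close>. Polar forms replace symmetric matrices throughout. The constants come from the
  passage between N points and (q - 1)N + 1 vectors: q^3 + q^2 - q is the number of vectors of a
  hyperbolic quadric, q^3 - q^2 + q that of an elliptic one, and 2q + 2 common points are 2q^2 - 1
  common vectors. In the sum over t, a vector off X is a zero of exactly one f + tQ, a common zero
  is one of all q of them; hence the number c of common vectors satisfies qc + q^4 - (q^3 - q^2 + q)
  \<le> q(q^3 + q^2 - q), that is c \<le> 2q(q - 1) + 1. The hypothesis q \<ge> 3 enters twice: it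
  makes q^2 - 2q - 1 positive, and it forces two non-tangent planes in a pencil whose axis is skew
  to X, so that the bound is attained.\<close>

definition functional :: "('a::field ^ 'n::finite \<Rightarrow> 'a) \<Rightarrow> bool" where
  "functional \<phi> \<longleftrightarrow> (\<forall>x y. \<phi> (x + y) = \<phi> x + \<phi> y) \<and> (\<forall>c x. \<phi> (c *s x) = c * \<phi> x)"

lemma functional_add: "functional \<phi> \<Longrightarrow> \<phi> (x + y) = \<phi> x + \<phi> y"
  and functional_scale: "functional \<phi> \<Longrightarrow> \<phi> (c *s x) = c * \<phi> x"
  by (auto simp: functional_def)

lemma functional_zero: "functional \<phi> \<Longrightarrow> \<phi> 0 = 0"
  using functional_scale[of \<phi> 0 0] by simp

lemma functional_comb: "functional \<phi> \<Longrightarrow> functional \<psi> \<Longrightarrow> functional (\<lambda>x. a * \<phi> x + b * \<psi> x)"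
  by (simp add: functional_def algebra_simps)

lemma functional_subspace: "functional \<phi> \<Longrightarrow> vec.subspace {x. \<phi> x = 0}"
  by (auto simp: vec.subspace_def functional_add functional_scale functional_zero)

text \<open>On each line in direction \<open>p\<close> the function \<open>h\<close> is affine with nonzero slope, so it has
  exactly one zero there.\<close>

lemma shift_count:
  fixes p :: "'a::{field, finite} ^ 'n::finite"
  assumes S: "\<And>x t. x \<in> S \<Longrightarrow> x + t *s p \<in> S"
    and h: "\<And>x t. x \<in> S \<Longrightarrow> h (x + t *s p) = h x + t * b x"
    and b: "\<And>x. x \<in> S \<Longrightarrow> b x \<noteq> (0::'a)"
  shows "CARD('a) * card {x \<in> S. h x = 0} = card S"
proof -
  \<comment> \<open>Every element of \<open>S\<close> is reached from the unique zero of
    \<open>h\<close> on its line in direction \<open>p\<close>.\<close>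
  have "bij_betw (\<lambda>(x, t). x + t *s p) ({x \<in> S. h x = 0} \<times> (UNIV :: 'a set)) S"
    unfolding bij_betw_def
  proof (intro conjI set_eqI iffI)
    show "inj_on (\<lambda>(x, t). x + t *s p) ({x \<in> S. h x = 0} \<times> UNIV)"
    proof (clarsimp simp: inj_on_def)
      fix x t y s
      assume *: "x \<in> S" "h x = 0" "y \<in> S" "h y = 0" "x + t *s p = y + s *s p"
      have "y = x + (t - s) *s p"
        using *(5) by (simp add: vec.scale_left_diff_distrib algebra_simps)
      then have "(t - s) * b x = 0"
        using h[of x "t - s"] * by simp
      then have "t = s" using b * by simp
      then show "x = y \<and> t = s" using * by simp
    qed
  next
    fix y assume "y \<in> (\<lambda>(x, t). x + t *s p) ` ({x \<in> S. h x = 0} \<times> UNIV)"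
    then show "y \<in> S" using S by auto
  next
    fix y assume y: "y \<in> S"
    let ?t = "h y / b y"
    have "y + (- ?t) *s p \<in> S" "h (y + (- ?t) *s p) = 0"
      using S[OF y] h[OF y] b[OF y] by (auto simp del: vec.scale_minus_left)
    moreover have "y = (y + (- ?t) *s p) + ?t *s p" by simp
    ultimately show "y \<in> (\<lambda>(x, t). x + t *s p) ` ({x \<in> S. h x = 0} \<times> UNIV)"
      by (intro image_eqI[of _ _ "(y + (- ?t) *s p, ?t)"]) auto
  qed
  from bij_betw_same_card[OF this] show ?thesis
    by (simp add: card_cartesian_product mult.commute)
qed

text \<open>Along direction \<open>u\<close> the functional itself is affine with constant slope
  \<open>\<phi> u\<close>.\<close>

lemma card_kernel:
  fixes \<phi> :: "'a::{field, finite} ^ 'n::finite \<Rightarrow> 'a"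
  assumes "vec.subspace U" "functional \<phi>" "u \<in> U" "\<phi> u \<noteq> 0"
  shows "CARD('a) * card {x \<in> U. \<phi> x = 0} = card U"
  by (rule shift_count[where p = u and b = "\<lambda>_. \<phi> u"])
     (use assms in \<open>auto simp: functional_add functional_scale vec.subspace_add vec.subspace_scale\<close>)

lemma span_insert_image:
  fixes a :: "'a::field ^ 'n::finite"
  shows "vec.span (insert a S) = (\<lambda>(x, t). x + t *s a) ` (vec.span S \<times> UNIV)"
proof (intro set_eqI iffI)
  fix y assume "y \<in> vec.span (insert a S)"
  then obtain k where "y - k *s a \<in> vec.span S" by (auto simp: vec.span_insert)
  then show "y \<in> (\<lambda>(x, t). x + t *s a) ` (vec.span S \<times> UNIV)"
    by (intro image_eqI[of _ _ "(y - k *s a, k)"]) auto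
next
  fix y assume "y \<in> (\<lambda>(x, t). x + t *s a) ` (vec.span S \<times> UNIV)"
  then obtain x t where "x \<in> vec.span S" "y = x + t *s a" by auto
  then have "y - t *s a \<in> vec.span S" by simp
  then show "y \<in> vec.span (insert a S)" by (auto simp: vec.span_insert)
qed

lemma span_singletonE:
  fixes p :: "'a::field ^ 'n::finite"
  assumes "x \<in> vec.span {p}"
  obtains c where "x = c *s p"
proof -
  obtain k where "x - k *s p = 0"
    using assms vec.span_breakdown_eq[of x p "{}"] by (simp add: vec.span_empty) blast
  then show thesis using that[of k] by simp
qed

lemma card_span_insert_le:
  fixes a :: "'a::{field, finite} ^ 'n::finite"
  shows "card (vec.span (insert a S)) \<le> CARD('a) * card (vec.span S)"
proof -
  have "card (vec.span (insert a S)) \<le> card (vec.span S \<times> (UNIV :: 'a set))"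
    unfolding span_insert_image by (rule card_image_le) auto
  then show ?thesis by (simp add: card_cartesian_product mult.commute)
qed

lemma card_span_insert:
  fixes a :: "'a::{field, finite} ^ 'n::finite"
  assumes "a \<notin> vec.span S"
  shows "card (vec.span (insert a S)) = CARD('a) * card (vec.span S)"
proof -
  have "inj_on (\<lambda>(x, t). x + t *s a) (vec.span S \<times> (UNIV :: 'a set))"
  proof (clarsimp simp: inj_on_def)
    fix x t y s
    assume *: "x \<in> vec.span S" "y \<in> vec.span S" "x + t *s a = y + s *s a"
    have "(t - s) *s a = y - x"
      using *(3) by (simp add: vec.scale_left_diff_distrib algebra_simps)
    then have "(t - s) *s a \<in> vec.span S"
      using * by (simp add: vec.span_diff)
    then have "t = s"
      using assms vec.span_scale[of "(t - s) *s a" S "1 / (t - s)"] by (cases "t = s") auto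
    then show "x = y \<and> t = s" using * by simp
  qed
  then show ?thesis
    unfolding span_insert_image by (simp add: card_image card_cartesian_product mult.commute)
qed

lemma card_span_independent:
  fixes B :: "('a::{field, finite} ^ 'n::finite) set"
  assumes "finite B" "vec.independent B"
  shows "card (vec.span B) = CARD('a) ^ card B"
  using assms
  by (induction B) (auto simp: vec.independent_insert card_span_insert)

lemma card_subspace:
  fixes W :: "('a::{field, finite} ^ 'n::finite) set"
  assumes "vec.subspace W"
  shows "card W = CARD('a) ^ vec.dim W"
proof -
  obtain B where B: "B \<subseteq> W" "vec.independent B" "W \<subseteq> vec.span B" "card B = vec.dim W"
    using vec.basis_exists by blast
  have "W = vec.span B"
    using B assms by (meson subset_antisym vec.span_minimal)
  then show ?thesis
    using card_span_independent[of B] B by (simp add: finite_subset)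
qed

text \<open>Pigeonhole: q^4 coefficient vectors yield only q^3 triples of values at
  \<open>u\<close>, \<open>v\<close>, \<open>w\<close>, so two of them agree there and their
  difference is the required functional.\<close>

lemma exists_functional_vanishing:
  fixes u v w :: "'a::{field, finite} ^ 4"
  obtains \<phi> z where "functional \<phi>" "\<phi> z = 1" "\<phi> u = 0" "\<phi> v = 0" "\<phi> w = 0"
proof -
  let ?d = "\<lambda>a x. \<Sum>i\<in>UNIV. (a $ i) * (x $ i) :: 'a"
  let ?T = "\<lambda>a::'a^4. (?d a u, ?d a v, ?d a w)"
  have "2 \<le> CARD('a)"
    using card_mono[of UNIV "{0, 1 :: 'a}"] by simp
  have "\<not> inj ?T"
  proof
    assume "inj ?T"
    then have "CARD('a ^ 4) \<le> CARD('a \<times> 'a \<times> 'a)"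
      by (intro card_inj_on_le[of ?T]) auto
    then have "CARD('a) ^ 4 \<le> CARD('a) ^ 3"
      by (simp add: power3_eq_cube mult.assoc)
    then show False
      using \<open>2 \<le> CARD('a)\<close> by (simp add: power_le_imp_le_exp)
  qed
  then obtain a b where ab: "a \<noteq> b" "?T a = ?T b" by (auto simp: inj_def)
  define c where "c = a - b"
  have "c \<noteq> 0" using ab by (simp add: c_def)
  then obtain i where i: "c $ i \<noteq> 0" by (auto simp: vec_eq_iff)
  have f: "functional (?d c)"
    by (auto simp: functional_def algebra_simps sum.distrib sum_distrib_left)
  \<comment> \<open>A scaled unit vector serves as \<open>z\<close>, normalizing the value to
    1.\<close>
  have "?d c (axis i (1 / c $ i)) = 1"
    using i by (simp add: axis_def if_distrib cong: if_cong)
  moreover have "?d c x = ?d a x - ?d b x" for x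
    by (simp add: c_def algebra_simps sum_subtractf)
  ultimately show thesis
    using that[OF f] ab by auto
qed

section \<open>Normalized representatives of projective points\<close>

lemma proj_points_multiple_unique:
  fixes x y :: "'a::field ^ 'n::{finite, linorder}"
  assumes "x \<in> proj_points" "y \<in> proj_points" "c *s x = d *s y" "c \<noteq> 0"
  shows "c = d \<and> x = y"
proof -
  obtain i where i: "x $ i = 1" "\<forall>j<i. x $ j = 0" using assms(1) by (auto simp: proj_points_def)
  obtain k where k: "y $ k = 1" "\<forall>j<k. y $ j = 0" using assms(2) by (auto simp: proj_points_def)
  have e: "c * x $ j = d * y $ j" for j using assms(3) by (metis vector_smult_component)
  have "i = k"
    using e[of i] e[of k] i k assms(4) by (cases i k rule: linorder_cases) auto
  then have "c = d" using e[of i] i k by simp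
  then show ?thesis using assms by simp
qed

lemma proj_points_multiple_exists:
  fixes x :: "'a::field ^ 'n::{finite, linorder}"
  assumes "x \<noteq> 0"
  obtains c where "c \<noteq> 0" "c *s x \<in> proj_points"
proof -
  have ne: "{i. x $ i \<noteq> 0} \<noteq> {}" using assms by (auto simp: vec_eq_iff)
  define i where "i = Min {i. x $ i \<noteq> 0}"
  have i: "x $ i \<noteq> 0" using Min_in[of "{i. x $ i \<noteq> 0}"] ne by (simp add: i_def)
  have "x $ j = 0" if "j < i" for j
    using that Min_le[of "{i. x $ i \<noteq> 0}" j] by (fastforce simp: i_def)
  then have "(1 / x $ i) *s x \<in> proj_points"
    using i by (auto simp: proj_points_def intro!: exI[of _ i])
  then show thesis using that[of "1 / x $ i"] i by simp
qed

text \<open>The dictionary between points and vectors: each nonzero vector is a unique nonzero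
  scalar times a unique normalized one. Only closure under scaling is assumed, so it applies to zero
  sets of forms as well as to subspaces.\<close>

lemma card_zero_set_cone:
  fixes S :: "('a::{field, finite} ^ 'n::{finite, linorder}) set"
  assumes "0 \<in> S" "\<And>c x. x \<in> S \<Longrightarrow> c *s x \<in> S"
  shows "card S = (CARD('a) - 1) * card (proj_points \<inter> S) + 1"
proof -
  have "bij_betw (\<lambda>(c, x). c *s x) ((UNIV - {0}) \<times> (proj_points \<inter> S)) (S - {0})"
    unfolding bij_betw_def
  proof (intro conjI set_eqI iffI)
    show "inj_on (\<lambda>(c, x). c *s x) ((UNIV - {0}) \<times> (proj_points \<inter> S))"
      using proj_points_multiple_unique by (auto simp: inj_on_def)
  next
    fix x assume "x \<in> (\<lambda>(c, x). c *s x) ` ((UNIV - {0}) \<times> (proj_points \<inter> S))"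
    then show "x \<in> S - {0}" using assms by (auto simp: proj_points_def)
  next
    fix x assume x: "x \<in> S - {0}"
    then obtain c where c: "c \<noteq> 0" "c *s x \<in> proj_points"
      using proj_points_multiple_exists by blast
    then have "x = (1 / c) *s (c *s x)" by simp
    then show "x \<in> (\<lambda>(c, x). c *s x) ` ((UNIV - {0}) \<times> (proj_points \<inter> S))"
      using c x assms(2) by (intro image_eqI[of _ _ "(1 / c, c *s x)"]) auto
  qed
  from bij_betw_same_card[OF this]
  have "card (S - {0}) = (CARD('a) - 1) * card (proj_points \<inter> S)"
    by (simp add: card_cartesian_product)
  moreover have "card S = card (S - {0}) + 1"
    using assms(1) by (metis Suc_eq_plus1 card_Suc_Diff1 finite)
  ultimately show ?thesis by simp
qed

section \<open>Quadratic functions\<close>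

definition bilinear_map :: "('a::field ^ 'n::finite \<Rightarrow> 'a ^ 'n \<Rightarrow> 'a) \<Rightarrow> bool" where
  "bilinear_map \<beta> \<longleftrightarrow> (\<forall>x. functional (\<beta> x)) \<and> (\<forall>y. functional (\<lambda>x. \<beta> x y))"

definition qform :: "('a::field ^ 'n::finite \<Rightarrow> 'a) \<Rightarrow> bool" where
  "qform Q \<longleftrightarrow> (\<exists>\<beta>. bilinear_map \<beta> \<and> (\<forall>x. Q x = \<beta> x x))"

definition polar :: "('a::field ^ 'n::finite \<Rightarrow> 'a) \<Rightarrow> 'a ^ 'n \<Rightarrow> 'a ^ 'n \<Rightarrow> 'a" where
  "polar Q x y = Q (x + y) - Q x - Q y"

lemma polar_sym: "polar Q x y = polar Q y x"
  by (simp add: polar_def add.commute)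

lemma qform_polar:
  assumes "qform Q"
  shows "functional (polar Q x)" "Q (c *s x) = c\<^sup>2 * Q x"
    "Q (x + t *s y) = Q x + t * polar Q x y + t\<^sup>2 * Q y" "polar Q x x = 2 * Q x"
proof -
  obtain \<beta> where \<beta>: "\<And>x. functional (\<beta> x)" "\<And>y. functional (\<lambda>x. \<beta> x y)" "\<And>x. Q x = \<beta> x x"
    using assms by (auto simp: qform_def bilinear_map_def)
  note s = functional_add[OF \<beta>(1)] functional_add[OF \<beta>(2)] functional_scale[OF \<beta>(1)]
    functional_scale[OF \<beta>(2)] \<beta>(3)
  have p: "polar Q x y = \<beta> x y + \<beta> y x" for x y
    by (simp add: polar_def s algebra_simps)
  show "functional (polar Q x)" "Q (c *s x) = c\<^sup>2 * Q x"
    "Q (x + t *s y) = Q x + t * polar Q x y + t\<^sup>2 * Q y" "polar Q x x = 2 * Q x"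
    by (auto simp: functional_def p s algebra_simps power2_eq_square)
qed

lemma qform_zero: "qform Q \<Longrightarrow> Q 0 = 0"
  using qform_polar(2)[of Q 0 0] by simp

lemma qform_prod: "functional \<phi> \<Longrightarrow> functional \<psi> \<Longrightarrow> qform (\<lambda>x. \<phi> x * \<psi> x)"
  unfolding qform_def bilinear_map_def
  by (intro exI[of _ "\<lambda>x y. \<phi> x * \<psi> y"]) (auto simp: functional_def algebra_simps)

lemma qform_add: "qform P \<Longrightarrow> qform Q \<Longrightarrow> qform (\<lambda>x. P x + Q x)"
  unfolding qform_def bilinear_map_def
  apply (elim exE)
  subgoal for \<beta> \<gamma>
    by (intro exI[of _ "\<lambda>x y. \<beta> x y + \<gamma> x y"]) (auto simp: functional_def algebra_simps)
  done

lemma qform_scale: "qform Q \<Longrightarrow> qform (\<lambda>x. c * Q x)"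
  unfolding qform_def bilinear_map_def
  apply (elim exE)
  subgoal for \<beta>
    by (intro exI[of _ "\<lambda>x y. c * \<beta> x y"]) (auto simp: functional_def algebra_simps)
  done

lemma qform_sum: "(\<And>i. i \<in> I \<Longrightarrow> qform (P i)) \<Longrightarrow> qform (\<lambda>x. \<Sum>i\<in>I. P i x)"
proof (induction I rule: infinite_finite_induct)
  case (insert i I)
  then show ?case by (simp add: qform_add)
qed (auto simp: qform_def bilinear_map_def functional_def intro!: exI[of _ "\<lambda>x y. 0"])

lemma qform_compose:
  fixes A :: "'a::field ^ 'm::finite ^ 'n::finite"
  shows "qform Q \<Longrightarrow> qform (\<lambda>x. Q (A *v x))"
  unfolding qform_def bilinear_map_def
  apply (elim exE)
  subgoal for \<beta>
    by (intro exI[of _ "\<lambda>x y. \<beta> (A *v x) (A *v y)"])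
       (auto simp: functional_def matrix_vector_right_distrib matrix_vector_mult_scaleR vec.scale)
  done

text \<open>A set of pairwise orthogonal singular vectors spans a totally singular subspace: adding
  a multiple of a generator changes \<open>Q\<close> only by polar and square terms, all of which
  are zero.\<close>

lemma qform_vanishes_span:
  assumes "qform Q" "\<And>x y. x \<in> S \<Longrightarrow> y \<in> S \<Longrightarrow> polar Q x y = 0" "\<And>x. x \<in> S \<Longrightarrow> Q x = 0"
    and x: "x \<in> vec.span S"
  shows "Q x = 0"
proof -
  have p: "polar Q x y = 0" if "x \<in> S" "y \<in> vec.span S" for x y
    using vec.span_minimal[OF _ functional_subspace[OF qform_polar(1)[OF assms(1), of x]], of S]
      assms(2) that by auto
  from x have "x \<in> vec.span S \<and> Q x = 0"
  proof (induction rule: vec.span_induct_alt)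
    case base
    then show ?case using qform_zero[OF assms(1)] by (simp add: vec.span_zero)
  next
    case (step c x y)
    have "Q (y + c *s x) = 0"
      unfolding qform_polar(3)[OF assms(1)]
      using step assms(3) p[of x y] by (simp add: polar_sym)
    then show ?case
      using step by (simp add: add.commute vec.span_add vec.span_scale vec.span_base)
  qed
  then show ?thesis ..
qed

text \<open>If \<open>Q\<close> vanishes on a hyperplane, expand \<open>Q\<close> at \<open>x = k + \<phi> x \<cdot> u\<close> with \<open>\<phi> k = 0\<close>.\<close>

lemma qform_factor:
  assumes Q: "qform Q" and \<phi>: "functional \<phi>" "\<phi> u = 1" and van: "\<And>x. \<phi> x = 0 \<Longrightarrow> Q x = 0"
  obtains \<psi> where "functional \<psi>" "\<And>x. Q x = \<phi> x * \<psi> x"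
proof
  show "functional (\<lambda>x. 1 * polar Q u x + (- Q u) * \<phi> x)"
    using qform_polar(1)[OF Q] \<phi>(1) by (rule functional_comb)
  fix x
  have "Q (x + (- \<phi> x) *s u) = 0"
    using \<phi> by (intro van) (simp add: functional_add functional_scale del: vec.scale_minus_left)
  then show "Q x = \<phi> x * (1 * polar Q u x + (- Q u) * \<phi> x)"
    unfolding qform_polar(3)[OF Q] by (simp add: polar_sym algebra_simps power2_eq_square)
qed

text \<open>For singular \<open>p\<close> the quadratic term of \<open>Q (x + t *s p)\<close>
  disappears, leaving an affine function of \<open>t\<close> with slope \<open>polar Q p x\<close>.
  The slope is constant along the line because \<open>polar Q p p = 2 * Q p = 0\<close>.\<close>

lemma shift_count_singular:
  fixes Q :: "'a::{field, finite} ^ 'n::finite \<Rightarrow> 'a"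
  assumes "qform Q" "Q p = 0" "vec.subspace U" "p \<in> U"
  shows "CARD('a) * card {x \<in> U. Q x = 0 \<and> polar Q p x \<noteq> 0} = card {x \<in> U. polar Q p x \<noteq> 0}"
proof -
  have pp: "polar Q p p = 0" using qform_polar(4)[OF assms(1)] assms by simp
  have "CARD('a) * card {x \<in> {x \<in> U. polar Q p x \<noteq> 0}. Q x = 0} = card {x \<in> U. polar Q p x \<noteq> 0}"
    by (rule shift_count[where p = p and b = "\<lambda>x. polar Q p x"])
       (use assms pp in \<open>auto simp: qform_polar functional_add[OF qform_polar(1)]
          functional_scale[OF qform_polar(1)] vec.subspace_add vec.subspace_scale polar_sym\<close>)
  then show ?thesis by (simp add: conj_ac)
qed

section \<open>Quadratic forms as polynomials\<close>

text \<open>Arbitrary degrees are needed to follow the factors of a substituted monomial;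
  \<open>quadratic_forms\<close> is the case \<open>d = 2\<close>.\<close>

definition homogeneous :: "nat \<Rightarrow> ('a::comm_ring_1, 'n::finite) mpoly \<Rightarrow> bool" where
  "homogeneous d f \<longleftrightarrow> (\<forall>m\<in>Poly_Mapping.keys f. (\<Sum>i\<in>UNIV. Poly_Mapping.lookup m i) = d)"

lemma homogeneous_add: "homogeneous d f \<Longrightarrow> homogeneous d g \<Longrightarrow> homogeneous d (f + g)"
  unfolding homogeneous_def by (meson Poly_Mapping.keys_add UnE subsetD)

lemma homogeneous_sum: "(\<And>i. i \<in> I \<Longrightarrow> homogeneous d (f i)) \<Longrightarrow> homogeneous d (\<Sum>i\<in>I. f i)"
  by (induction I rule: infinite_finite_induct)
     (auto simp: homogeneous_add, auto simp: homogeneous_def)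

lemma homogeneous_mult:
  assumes "homogeneous d f" "homogeneous e g"
  shows "homogeneous (d + e) (f * g)"
proof -
  have "(\<Sum>i\<in>UNIV. Poly_Mapping.lookup m i) = d + e" if m: "m \<in> Poly_Mapping.keys (f * g)" for m
  proof -
    obtain k l where "k \<in> Poly_Mapping.keys f" "l \<in> Poly_Mapping.keys g" "m = k + l"
      using m keys_mult[of f g] by blast
    then show ?thesis
      using assms by (simp add: homogeneous_def lookup_add sum.distrib)
  qed
  then show ?thesis by (simp add: homogeneous_def)
qed

lemma homogeneous_1: "homogeneous 0 1"
  by (simp add: homogeneous_def)

lemma homogeneous_power: "homogeneous d f \<Longrightarrow> homogeneous (k * d) (f ^ k)"
  by (induction k) (auto simp: homogeneous_1 homogeneous_mult)

lemma homogeneous_prod: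
  "(\<And>i. i \<in> I \<Longrightarrow> homogeneous (d i) (f i)) \<Longrightarrow> homogeneous (\<Sum>i\<in>I. d i) (\<Prod>i\<in>I. f i)"
  by (induction I rule: infinite_finite_induct) (auto simp: homogeneous_1 homogeneous_mult)

lemma homogeneous_single: "(\<Sum>i\<in>UNIV. Poly_Mapping.lookup m i) = d \<Longrightarrow> homogeneous d (Poly_Mapping.single m c)"
  by (simp add: homogeneous_def)

lemma sum_lookup_single:
  "(\<Sum>i\<in>(UNIV :: 'n::finite set). Poly_Mapping.lookup (Poly_Mapping.single j k) i) = k"
  by (simp add: lookup_single when_def)

lemma lin_subst_quadratic:
  assumes "f \<in> quadratic_forms"
  shows "lin_subst A f \<in> quadratic_forms"
proof -
  have "homogeneous 2 (lin_subst A f)"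
    unfolding lin_subst_def
  proof (rule homogeneous_sum)
    fix m assume m: "m \<in> Poly_Mapping.keys f"
    \<comment> \<open>The degree is kept in the shape in which it arises: 0 from the coefficient,
      and 1 from each linear form, taken as often as its exponent says.\<close>
    have "homogeneous (0 + (\<Sum>i\<in>UNIV. Poly_Mapping.lookup m i * 1))
      (Poly_Mapping.single 0 (Poly_Mapping.lookup f m) *
        (\<Prod>i\<in>UNIV. (\<Sum>j\<in>UNIV. Poly_Mapping.single (Poly_Mapping.single j 1) (A $ i $ j))
                   ^ Poly_Mapping.lookup m i))"
      by (intro homogeneous_mult homogeneous_prod homogeneous_power homogeneous_sum homogeneous_single)
         (auto simp: sum_lookup_single)
    then show "homogeneous 2 (Poly_Mapping.single 0 (Poly_Mapping.lookup f m) *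
        (\<Prod>i\<in>UNIV. (\<Sum>j\<in>UNIV. Poly_Mapping.single (Poly_Mapping.single j 1) (A $ i $ j))
                   ^ Poly_Mapping.lookup m i))"
      using m assms by (simp add: quadratic_forms_def)
  qed
  then show ?thesis by (simp add: quadratic_forms_def homogeneous_def)
qed

section \<open>Evaluation of polynomials\<close>

definition monomial_eval :: "'a::comm_ring_1 ^ 'n::finite \<Rightarrow> ('n \<Rightarrow>\<^sub>0 nat) \<Rightarrow> 'a" where
  "monomial_eval x m = (\<Prod>i\<in>UNIV. (x $ i) ^ Poly_Mapping.lookup m i)"

text \<open>Permits summing over a set of monomials common to several polynomials, as required for
  additivity.\<close>

lemma poly_eval_monomials:
  assumes "Poly_Mapping.keys f \<subseteq> K" "finite K"
  shows "poly_eval f x = (\<Sum>m\<in>K. Poly_Mapping.lookup f m * monomial_eval x m)"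
  unfolding poly_eval_def monomial_eval_def
  using assms by (intro sum.mono_neutral_left) (auto simp: in_keys_iff)

lemma poly_eval_add: "poly_eval (f + g) x = poly_eval f x + poly_eval g x"
proof -
  let ?K = "Poly_Mapping.keys f \<union> Poly_Mapping.keys g"
  have "poly_eval (f + g) x = (\<Sum>m\<in>?K. Poly_Mapping.lookup (f + g) m * monomial_eval x m)"
    by (intro poly_eval_monomials Poly_Mapping.keys_add) auto
  also have "\<dots> = poly_eval f x + poly_eval g x"
    by (subst (1 2) poly_eval_monomials[where K = ?K])
       (auto simp: lookup_add algebra_simps sum.distrib)
  finally show ?thesis .
qed

lemma poly_eval_0 [simp]: "poly_eval 0 x = 0"
  by (simp add: poly_eval_def)

lemma poly_eval_sum: "poly_eval (\<Sum>i\<in>I. f i) x = (\<Sum>i\<in>I. poly_eval (f i) x)"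
  by (induction I rule: infinite_finite_induct) (auto simp: poly_eval_add)

lemma poly_eval_single: "poly_eval (Poly_Mapping.single m c) x = c * monomial_eval x m"
  by (subst poly_eval_monomials[where K = "{m}"]) auto

lemma monomial_eval_add: "monomial_eval x (m + n) = monomial_eval x m * monomial_eval x n"
  by (simp add: monomial_eval_def lookup_add power_add prod.distrib)

lemma poly_mapping_sum_singles:
  "f = (\<Sum>m\<in>Poly_Mapping.keys f. Poly_Mapping.single m (Poly_Mapping.lookup f m))"
  by (rule poly_mapping_eqI) (auto simp: lookup_sum lookup_single when_def in_keys_iff)

lemma poly_eval_mult: "poly_eval (f * g) x = poly_eval f x * poly_eval g x"
proof -
  let ?s = "\<lambda>f m. Poly_Mapping.single m (Poly_Mapping.lookup f m)"
  have "f * g = (\<Sum>m\<in>Poly_Mapping.keys f. ?s f m) * (\<Sum>n\<in>Poly_Mapping.keys g. ?s g n)"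
    using poly_mapping_sum_singles[of f] poly_mapping_sum_singles[of g] by simp
  also have "poly_eval \<dots> x = (\<Sum>m\<in>Poly_Mapping.keys f. \<Sum>n\<in>Poly_Mapping.keys g.
      (Poly_Mapping.lookup f m * monomial_eval x m) * (Poly_Mapping.lookup g n * monomial_eval x n))"
    by (simp add: sum_product poly_eval_sum mult_single poly_eval_single monomial_eval_add algebra_simps)
  also have "\<dots> = poly_eval f x * poly_eval g x"
    by (simp add: sum_product poly_eval_def monomial_eval_def)
  finally show ?thesis .
qed

lemma poly_eval_1 [simp]: "poly_eval 1 x = 1"
  using poly_eval_single[of 0 1 x] by (simp add: monomial_eval_def)

lemma poly_eval_power: "poly_eval (f ^ k) x = poly_eval f x ^ k"
  by (induction k) (auto simp: poly_eval_mult)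

lemma poly_eval_prod: "poly_eval (\<Prod>i\<in>I. f i) x = (\<Prod>i\<in>I. poly_eval (f i) x)"
  by (induction I rule: infinite_finite_induct) (auto simp: poly_eval_mult)

lemma monomial_eval_single: "monomial_eval x (Poly_Mapping.single j 1) = x $ j"
  by (simp add: monomial_eval_def lookup_single when_def if_distrib[of "power _"] prod.delta cong: if_cong)

lemma poly_eval_lin_subst: "poly_eval (lin_subst A f) x = poly_eval f (A *v x)"
proof -
  have "monomial_eval x 0 = 1" by (simp add: monomial_eval_def)
  then show ?thesis
    unfolding lin_subst_def
    by (simp add: poly_eval_sum poly_eval_mult poly_eval_prod poly_eval_power poly_eval_single
      monomial_eval_single poly_eval_def[of f] matrix_vector_mult_def)
       (simp add: monomial_eval_single[unfolded One_nat_def])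
qed

lemma monomial_degree_2:
  fixes m :: "'n::finite \<Rightarrow>\<^sub>0 nat"
  assumes "(\<Sum>i\<in>UNIV. Poly_Mapping.lookup m i) = 2"
  obtains i j where "m = Poly_Mapping.single i 1 + Poly_Mapping.single j 1"
proof -
  \<comment> \<open>One indeterminate is peeled off; doing so twice leaves a monomial of degree
    0.\<close>
  have split: "\<exists>i n. m = Poly_Mapping.single i 1 + n \<and> (\<Sum>i\<in>UNIV. Poly_Mapping.lookup n i) = d"
    if d: "(\<Sum>i\<in>UNIV. Poly_Mapping.lookup m i) = Suc d" for m :: "'n \<Rightarrow>\<^sub>0 nat" and d
  proof -
    have "\<exists>i. Poly_Mapping.lookup m i \<noteq> 0"
      using d by (metis sum.neutral nat.distinct(1))
    then obtain i where i: "Poly_Mapping.lookup m i \<noteq> 0" ..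
    have "m = Poly_Mapping.single i 1 + (m - Poly_Mapping.single i 1)"
      using i by (intro poly_mapping_eqI) (auto simp: lookup_add lookup_minus lookup_single when_def)
    moreover from this
    have "Suc d = (\<Sum>k\<in>UNIV. Poly_Mapping.lookup (Poly_Mapping.single i 1 + (m - Poly_Mapping.single i 1)) k)"
      using d by simp
    then have "(\<Sum>k\<in>UNIV. Poly_Mapping.lookup (m - Poly_Mapping.single i 1) k) = d"
      unfolding lookup_add sum.distrib sum_lookup_single by simp
    ultimately show ?thesis by blast
  qed
  obtain i n where n: "m = Poly_Mapping.single i 1 + n" "(\<Sum>i\<in>UNIV. Poly_Mapping.lookup n i) = 1"
    using split[of m 1] assms by (auto simp: numeral_2_eq_2)
  obtain j k where k: "n = Poly_Mapping.single j 1 + k" "(\<Sum>i\<in>UNIV. Poly_Mapping.lookup k i) = 0"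
    using split[of n 0] n by auto
  have "k = 0" using k(2) by (intro poly_mapping_eqI) simp
  then show thesis using that n k by simp
qed

lemma functional_component: "functional (\<lambda>x. x $ i)"
  by (simp add: functional_def)

lemma poly_eval_qform:
  assumes "f \<in> quadratic_forms"
  shows "qform (poly_eval f)"
proof -
  have "qform (\<lambda>x. monomial_eval x m)" if m: "m \<in> Poly_Mapping.keys f" for m
  proof -
    obtain i j where "m = Poly_Mapping.single i 1 + Poly_Mapping.single j 1"
      using monomial_degree_2 m assms by (metis (mono_tags, lifting) mem_Collect_eq quadratic_forms_def)
    then show ?thesis
      by (simp add: monomial_eval_add monomial_eval_single[unfolded One_nat_def] qform_prod functional_component)
  qed
  then show ?thesis
    unfolding poly_eval_def[abs_def] monomial_eval_def[symmetric]
    by (intro qform_sum qform_scale)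
qed

lemma functional_basis:
  fixes \<phi> :: "'a::field ^ 'n::finite \<Rightarrow> 'a"
  assumes "functional \<phi>"
  shows "\<phi> x = (\<Sum>i\<in>UNIV. x $ i * \<phi> (axis i 1))"
proof -
  have s: "\<phi> (\<Sum>i\<in>I. f i) = (\<Sum>i\<in>I. \<phi> (f i))" for I :: "'n set" and f
    by (induction I rule: infinite_finite_induct) (auto simp: functional_zero[OF assms] functional_add[OF assms])
  have "\<phi> (\<Sum>i\<in>UNIV. x $ i *s axis i 1) = (\<Sum>i\<in>UNIV. x $ i * \<phi> (axis i 1))"
    by (simp add: s functional_scale[OF assms])
  then show ?thesis by (simp add: basis_expansion)
qed

text \<open>Leads back from functions to codewords: a product of two linear functionals, found by
  counting, has to be the evaluation of an actual form.\<close>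

lemma qform_poly:
  fixes Q :: "'a::field ^ 'n::finite \<Rightarrow> 'a"
  assumes "qform Q"
  obtains f where "f \<in> quadratic_forms" "poly_eval f = Q"
proof -
  obtain \<beta> where \<beta>: "\<And>x. functional (\<beta> x)" "\<And>y. functional (\<lambda>x. \<beta> x y)" "\<And>x. Q x = \<beta> x x"
    using assms by (auto simp: qform_def bilinear_map_def)
  define f :: "('a, 'n) mpoly" where "f = (\<Sum>i\<in>UNIV. \<Sum>j\<in>UNIV.
    Poly_Mapping.single (Poly_Mapping.single i 1 + Poly_Mapping.single j 1) (\<beta> (axis i 1) (axis j 1)))"
  have "homogeneous 2 f"
    unfolding f_def
    by (intro homogeneous_sum homogeneous_single) (simp add: lookup_add sum.distrib sum_lookup_single)
  then have "f \<in> quadratic_forms" by (simp add: quadratic_forms_def homogeneous_def)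
  moreover have "poly_eval f x = Q x" for x
  proof -
    have "Q x = (\<Sum>i\<in>UNIV. x $ i * (\<Sum>j\<in>UNIV. x $ j * \<beta> (axis i 1) (axis j 1)))"
      unfolding \<beta>(3) by (subst functional_basis[OF \<beta>(2)], subst functional_basis[OF \<beta>(1)]) simp
    then show ?thesis
      by (simp add: f_def poly_eval_sum poly_eval_single monomial_eval_add
        monomial_eval_single[unfolded One_nat_def] sum_distrib_left algebra_simps)
  qed
  ultimately show thesis using that by blast
qed

text \<open>Evaluating at the indicator vector of \<open>S\<close> sums the coefficients of the monomials in the
  indeterminates from \<open>S\<close>; the sets \<open>S\<close> with at most two elements then isolate every coefficient
  of a quadratic form.\<close>

lemma poly_eval_indicator:
  fixes f :: "('a::comm_ring_1, 'n::finite) mpoly"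
  shows
  "poly_eval f (\<chi> i. if i \<in> S then 1 else 0) =
    (\<Sum>m\<in>{m \<in> Poly_Mapping.keys f. Poly_Mapping.keys m \<subseteq> S}. Poly_Mapping.lookup f m)"
proof -
  have "monomial_eval (\<chi> i. if i \<in> S then (1::'a) else 0) m = (if Poly_Mapping.keys m \<subseteq> S then 1 else 0)" for m
  proof (cases "Poly_Mapping.keys m \<subseteq> S")
    case True
    then show ?thesis
      by (auto simp: monomial_eval_def in_keys_iff subset_eq intro!: prod.neutral)
  next
    case False
    then obtain i where i: "i \<notin> S" "Poly_Mapping.lookup m i \<noteq> 0" by (auto simp: in_keys_iff)
    have "(\<Prod>i\<in>UNIV. ((\<chi> i. if i \<in> S then 1 else 0) $ i :: 'a) ^ Poly_Mapping.lookup m i) = 0"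
      using i by (intro prod_zero bexI[of _ i]) (auto simp: zero_power)
    then show ?thesis using False by (simp add: monomial_eval_def)
  qed
  then have "poly_eval f (\<chi> i. if i \<in> S then 1 else 0) =
      (\<Sum>m\<in>Poly_Mapping.keys f. if Poly_Mapping.keys m \<subseteq> S then Poly_Mapping.lookup f m else 0)"
    by (subst poly_eval_monomials[OF order_refl]) (auto intro!: sum.cong)
  then show ?thesis by (simp add: sum.inter_filter)
qed

text \<open>Over a finite field invariance of the values need not control the coefficients of a
  polynomial. In degree 2 it does: adding \<open>axis j 1\<close> turns the indicator vector of
  \<open>S\<close> into that of \<open>insert j S\<close>, and these values determine every
  coefficient of a monomial containing \<open>j\<close>.\<close>

lemma not_in_indets:
  fixes f :: "('a::field, 'n::finite) mpoly"
  assumes f: "f \<in> quadratic_forms" and inv: "\<And>x. poly_eval f (x + axis j 1) = poly_eval f x"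
  shows "j \<notin> indets f"
proof
  assume "j \<in> indets f"
  then obtain m where m: "m \<in> Poly_Mapping.keys f" "j \<in> Poly_Mapping.keys m"
    by (auto simp: indets_def)
  have deg: "\<exists>i j. n = Poly_Mapping.single i 1 + Poly_Mapping.single j 1" if "n \<in> Poly_Mapping.keys f" for n
    using monomial_degree_2 f that by (metis (mono_tags, lifting) mem_Collect_eq quadratic_forms_def)
  have ks: "Poly_Mapping.keys (Poly_Mapping.single i 1 + Poly_Mapping.single j (1::nat)) = {i, j}" for i j :: 'n
    by (auto simp: in_keys_iff lookup_add lookup_single when_def split: if_splits)
  obtain i where i: "m = Poly_Mapping.single i 1 + Poly_Mapping.single j 1"
    using deg[OF m(1)] m(2) ks by (metis add.commute empty_iff insert_iff)
  let ?v = "\<lambda>S. poly_eval f (\<chi> i. if i \<in> S then 1 else 0)"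
  let ?K = "\<lambda>S. {m \<in> Poly_Mapping.keys f. Poly_Mapping.keys m \<subseteq> S}"
  have nz: "Poly_Mapping.keys n \<noteq> {}" if "n \<in> Poly_Mapping.keys f" for n
    using deg[OF that] ks by fastforce
  have unique: "n = m" if n: "n \<in> Poly_Mapping.keys f" "Poly_Mapping.keys n = {i, j}" for n
  proof -
    obtain k l where kl: "n = Poly_Mapping.single k 1 + Poly_Mapping.single l 1"
      using deg[OF n(1)] by blast
    then have "{k, l} = {i, j}" using n(2) ks[of k l] kl by simp
    then show ?thesis unfolding kl i by (auto simp: doubleton_eq_iff add.commute)
  qed
  have ins: "?v (insert j S) = ?v S" if "j \<notin> S" for S
  proof -
    have "(\<chi> i. if i \<in> insert j S then 1 else 0) = (\<chi> i. if i \<in> S then 1 else 0) + axis j (1::'a)"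
      using that by (auto simp: vec_eq_iff axis_def)
    then show ?thesis using inv by simp
  qed
  have v0: "?v {} = 0"
    unfolding poly_eval_indicator using nz by (intro sum.neutral) auto
  have "Poly_Mapping.lookup f m = 0"
  \<comment> \<open>The coefficient of the square is the value at {j}, which equals the value 0 at
    the empty set; that of a mixed monomial is the value at {j, i} minus those at {j} and
    {i}.\<close>
  proof (cases "i = j")
    case True
    have "n = m" if "n \<in> ?K {j}" for n
      using that unique[of n] nz[of n] True by (auto simp: subset_singleton_iff)
    moreover have "m \<in> ?K {j}" using m(1) True ks[of j j] i by simp
    ultimately have "?K {j} = {m}" by blast
    then have "?v {j} = Poly_Mapping.lookup f m"
      unfolding poly_eval_indicator by simp
    then show ?thesis
      using ins[of "{}"] v0 by (simp del: insert_iff)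
  next
    case False
    have "?K {j, i} = insert m (?K {j} \<union> ?K {i})"
    proof (intro set_eqI iffI)
      fix n assume n: "n \<in> ?K {j, i}"
      then consider "i \<notin> Poly_Mapping.keys n" | "j \<notin> Poly_Mapping.keys n" | "Poly_Mapping.keys n = {i, j}"
        by blast
      then show "n \<in> insert m (?K {j} \<union> ?K {i})"
        using n unique[of n] by cases auto
    next
      fix n assume "n \<in> insert m (?K {j} \<union> ?K {i})"
      then show "n \<in> ?K {j, i}" using m(1) i ks[of i j] by auto
    qed
    moreover have "m \<notin> ?K {j} \<union> ?K {i}"
      using False i ks[of i j] by auto
    moreover have "?K {j} \<inter> ?K {i} = {}"
      using nz False by (auto simp: subset_singleton_iff)
    ultimately have "?v {j, i} = Poly_Mapping.lookup f m + (?v {j} + ?v {i})"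
      unfolding poly_eval_indicator by (simp add: sum.union_disjoint)
    then show ?thesis
      using ins[of "{i}"] ins[of "{}"] v0 False by simp
  qed
  then show False using m by (simp add: in_keys_iff)
qed

section \<open>Rank and radical vectors\<close>

lemma poly_eval_shift:
  assumes "j \<notin> indets f"
  shows "poly_eval f (x + c *s axis j 1) = poly_eval f x"
proof -
  have "monomial_eval (x + c *s axis j 1) m = monomial_eval x m" if "m \<in> Poly_Mapping.keys f" for m
  proof -
    have "Poly_Mapping.lookup m j = 0"
      using assms that by (auto simp: indets_def in_keys_iff)
    then show ?thesis
      unfolding monomial_eval_def by (intro prod.cong) (auto simp: axis_def)
  qed
  then show ?thesis by (simp add: poly_eval_monomials[OF order_refl])
qed

lemma form_rank_attained:
  fixes f :: "('a::field, 'n::finite) mpoly"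
  obtains A :: "'a ^ 'n ^ 'n" where "invertible A" "card (indets (lin_subst A f)) = form_rank f"
proof -
  have "invertible (mat 1 :: 'a ^ 'n ^ 'n)"
    unfolding invertible_def by (metis matrix_mul_lid)
  then have "\<exists>r. \<exists>A :: 'a ^ 'n ^ 'n. invertible A \<and> card (indets (lin_subst A f)) = r"
    by blast
  from LeastI_ex[OF this] show thesis
    using that unfolding form_rank_def by blast
qed

lemma form_rank_le: "form_rank f \<le> CARD('n)" for f :: "('a::field, 'n::finite) mpoly"
  by (metis form_rank_attained card_mono finite_code subset_UNIV)

text \<open>If \<open>x_j\<close> is absent after the substitution \<open>A\<close>, the
  \<open>j\<close>-th column of \<open>A\<close> is a direction in which the form is
  constant.\<close>

lemma form_rank_less_radical:
  fixes f :: "('a::field, 'n::finite) mpoly"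
  assumes "form_rank f < CARD('n)"
  obtains v where "v \<noteq> 0" "\<And>x c. poly_eval f (x + c *s v) = poly_eval f x"
proof -
  obtain A :: "'a ^ 'n ^ 'n" where A: "invertible A" "card (indets (lin_subst A f)) = form_rank f"
    by (rule form_rank_attained)
  have "indets (lin_subst A f) \<noteq> UNIV" using A(2) assms by auto
  then obtain j where j: "j \<notin> indets (lin_subst A f)" by blast
  obtain B where B: "A ** B = mat 1" "B ** A = mat 1" using A(1) by (auto simp: invertible_def)
  have AB: "A *v (B *v x) = x" "B *v (A *v y) = y" for x y
    by (simp_all add: matrix_vector_mul_assoc B)
  show thesis
  proof (rule that)
    show "A *v axis j 1 \<noteq> 0"
      by (metis AB(2) matrix_vector_mult_0_right axis_eq_0_iff zero_neq_one)
    fix x c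
    have "poly_eval (lin_subst A f) (B *v x + c *s axis j 1) = poly_eval (lin_subst A f) (B *v x)"
      by (rule poly_eval_shift[OF j])
    then show "poly_eval f (x + c *s (A *v axis j 1)) = poly_eval f x"
      by (simp add: poly_eval_lin_subst matrix_vector_right_distrib vec.scale AB)
  qed
qed

text \<open>A coordinate change having \<open>v\<close> as one of its columns eliminates the
  corresponding indeterminate.\<close>

lemma radical_form_rank_less:
  fixes f :: "('a::field, 'n::finite) mpoly"
  assumes f: "f \<in> quadratic_forms" and v: "v \<noteq> 0" "\<And>x. poly_eval f (x + v) = poly_eval f x"
  shows "form_rank f < CARD('n)"
proof -
  obtain i where i: "v $ i \<noteq> 0" using v(1) by (auto simp: vec_eq_iff)
  \<comment> \<open>The identity matrix with its \<open>i\<close>-th column replaced by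
    \<open>a\<close>; the inverse of such a matrix has the same shape, as \<open>B\<close>
    shows.\<close>
  define E where "E a = (\<chi> r c. if c = i then a r else if r = c then 1 else 0)" for a :: "'n \<Rightarrow> 'a"
  have E: "E a *v x = (\<chi> r. a r * x $ i + (if r = i then 0 else x $ r))" for a x
  proof -
    have "(\<Sum>c\<in>UNIV. (if c = i then a r else if r = c then 1 else 0) * x $ c)
        = a r * x $ i + (\<Sum>c\<in>UNIV - {i}. if r = c then x $ c else 0)" for r
      by (subst sum.remove[of UNIV i])
         (simp_all add: if_distrib[of "\<lambda>t. t * _"] cong: if_cong)
    then show ?thesis by (simp add: E_def matrix_vector_mult_def vec_eq_iff)
  qed
  define A where "A = E (\<lambda>r. v $ r)"
  define B where "B = E (\<lambda>r. if r = i then 1 / v $ i else - (v $ r / v $ i))"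
  have "A *v (B *v x) = x" "B *v (A *v x) = x" for x
    unfolding A_def B_def E using i by (auto simp: vec_eq_iff field_simps)
  then have "A ** B = mat 1" "B ** A = mat 1"
    by (simp_all add: matrix_eq flip: matrix_vector_mul_assoc)
  then have "invertible A" by (auto simp: invertible_def)
  have "A *v axis i 1 = v" unfolding A_def E by (auto simp: vec_eq_iff axis_def)
  then have "i \<notin> indets (lin_subst A f)"
    by (intro not_in_indets lin_subst_quadratic f)
       (simp add: poly_eval_lin_subst matrix_vector_right_distrib v(2))
  then have "card (indets (lin_subst A f)) < CARD('n)"
    by (intro psubset_card_mono) auto
  moreover have "form_rank f \<le> card (indets (lin_subst A f))"
    unfolding form_rank_def using \<open>invertible A\<close> by (intro Least_le) blast
  ultimately show ?thesis by simp
qed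

section \<open>Zeros of quadratic forms in four variables\<close>

lemma card_field_ge_2: "2 \<le> CARD('a::{field, finite})"
  using card_mono[of UNIV "{0, 1 :: 'a}"] by simp

lemma card_split: "finite S \<Longrightarrow> card S = card {x \<in> S. P x} + card {x \<in> S. \<not> P x}"
  by (subst card_Un_disjoint[symmetric]) (auto intro: arg_cong[of _ _ card])

lemma card_vec4: "CARD('a::finite ^ 4) = CARD('a) ^ 4"
  by simp

lemma kernel_subset_span:
  fixes \<phi> :: "'a::{field, finite} ^ 4 \<Rightarrow> 'a"
  assumes "functional \<phi>" "\<phi> u \<noteq> 0" "S \<subseteq> {x. \<phi> x = 0}" "card (vec.span S) = CARD('a) ^ 3"
  shows "{x. \<phi> x = 0} = vec.span S"
proof -
  have "CARD('a) * card {x \<in> UNIV. \<phi> x = 0} = CARD('a ^ 4)"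
    by (rule card_kernel) (use assms in auto)
  then have "CARD('a) * card {x. \<phi> x = 0} = CARD('a) * CARD('a) ^ 3"
    unfolding card_vec4 by (simp add: eval_nat_numeral)
  then have "card {x. \<phi> x = 0} = card (vec.span S)" using assms(4) by simp
  moreover have "vec.span S \<subseteq> {x. \<phi> x = 0}"
    using assms by (intro vec.span_minimal functional_subspace)
  ultimately show ?thesis by (metis card_subset_eq finite)
qed

text \<open>Take a maximal totally singular subspace. If its dimension is at most 2, then outside the
  points orthogonal to it every line in one of its directions contains exactly one zero, which
  bounds the number of zeros; if it is at least 3, then \<open>Q\<close> vanishes on a hyperplane.\<close>

lemma qform_zeros_bound:
  fixes Q :: "'a::{field, finite} ^ 4 \<Rightarrow> 'a"
  assumes Q: "qform Q"
  obtains "card {x. Q x = 0} + CARD('a) \<le> CARD('a) ^ 3 + CARD('a)\<^sup>2"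
  | \<phi> \<psi> where "functional \<phi>" "functional \<psi>" "\<And>x. Q x = \<phi> x * \<psi> x"
proof -
  let ?q = "CARD('a)"
  have q: "2 \<le> ?q" by (rule card_field_ge_2)
  have q2: "2 * ?q \<le> ?q\<^sup>2" using q by (simp add: power2_eq_square)
  have q3: "?q\<^sup>2 \<le> ?q ^ 3" using q by (intro power_increasing) auto
  note fp = qform_polar(1)[OF Q]
  \<comment> \<open>The cases are: no singular vector, a maximal totally singular subspace of
    dimension 1, or a totally singular subspace of dimension 2, spanned by \<open>p\<close> and
    \<open>r\<close>.\<close>
  consider (none) "\<And>x. Q x = 0 \<Longrightarrow> x = 0"
    | (point) p where "p \<noteq> 0" "Q p = 0" "\<And>x. Q x = 0 \<Longrightarrow> polar Q p x = 0 \<Longrightarrow> x \<in> vec.span {p}"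
    | (line) p r where "p \<noteq> 0" "Q p = 0" "Q r = 0" "polar Q p r = 0" "r \<notin> vec.span {p}"
    by metis
  then show thesis
  proof cases
    case none
    then have "card {x. Q x = 0} \<le> card {0 :: 'a ^ 4}" by (intro card_mono) auto
    then show thesis using that(1) q q2 q3 by simp
  next
    case point
    have "?q * card {x. Q x = 0 \<and> polar Q p x \<noteq> 0} = card {x. polar Q p x \<noteq> 0}"
      using shift_count_singular[OF Q point(2), of UNIV] by simp
    also have "\<dots> \<le> CARD('a ^ 4)" by (intro card_mono) auto
    also have "\<dots> = ?q * ?q ^ 3" unfolding card_vec4 by (simp add: eval_nat_numeral)
    finally have "card {x. Q x = 0 \<and> polar Q p x \<noteq> 0} \<le> ?q ^ 3" using q by simp
    moreover have "card {x. Q x = 0 \<and> polar Q p x = 0} \<le> card (vec.span {p})"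
      by (intro card_mono) (use point in auto)
    moreover have "card (vec.span {p}) \<le> ?q" using card_span_insert_le[of p "{}"] by simp
    moreover have "card {x. Q x = 0} = card {x. Q x = 0 \<and> polar Q p x = 0} + card {x. Q x = 0 \<and> polar Q p x \<noteq> 0}"
      using card_split[of "{x. Q x = 0}" "\<lambda>x. polar Q p x = 0"] by simp
    ultimately show thesis using that(1) q2 by linarith
  next
    case line
    let ?L = "vec.span {r, p}"
    have pp: "polar Q p p = 0" "polar Q r r = 0" using qform_polar(4)[OF Q] line by auto
    have cp: "card (vec.span {p}) = ?q" using card_span_insert[of p "{}"] line by simp
    have cL: "card ?L = ?q\<^sup>2" using card_span_insert[of r "{p}"] line cp by (simp add: power2_eq_square)
    show thesis
    proof (cases "\<exists>z. Q z = 0 \<and> polar Q p z = 0 \<and> polar Q r z = 0 \<and> z \<notin> ?L")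
      case True
      then obtain z where z: "Q z = 0" "polar Q p z = 0" "polar Q r z = 0" "z \<notin> ?L" by blast
      obtain \<phi> u where \<phi>: "functional \<phi>" "\<phi> u = 1" "\<phi> z = 0" "\<phi> r = 0" "\<phi> p = 0"
        by (rule exists_functional_vanishing)
      have "polar Q z z = 0" "polar Q z p = 0" "polar Q z r = 0" "polar Q r p = 0"
        using qform_polar(4)[OF Q, of z] z line(4) polar_sym[of Q z p] polar_sym[of Q z r] polar_sym[of Q r p]
        by simp_all
      then have van: "Q x = 0" if "x \<in> vec.span {z, r, p}" for x
        using that by (intro qform_vanishes_span[OF Q _ _ that])
          (use z line pp in auto)
      have "card (vec.span {z, r, p}) = ?q ^ 3"
        using card_span_insert[OF z(4)] cL by (simp add: power2_eq_square power3_eq_cube)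
      then have "{x. \<phi> x = 0} = vec.span {z, r, p}"
        using \<phi> by (intro kernel_subset_span[of \<phi> u]) auto
      then have "Q x = 0" if "\<phi> x = 0" for x using van that by blast
      then obtain \<psi> where "functional \<psi>" "\<And>x. Q x = \<phi> x * \<psi> x"
        using qform_factor[OF Q \<phi>(1,2)] by blast
      then show thesis using that(2) \<phi>(1) by blast
    next
      case False
      let ?U = "{x. polar Q p x = 0}"
      have 1: "?q * card {x. Q x = 0 \<and> polar Q p x \<noteq> 0} = card {x. polar Q p x \<noteq> 0}"
        using shift_count_singular[OF Q line(2), of UNIV] by simp
      have 2: "?q * card {x. Q x = 0 \<and> polar Q p x = 0 \<and> polar Q r x \<noteq> 0}
          = card {x. polar Q p x = 0 \<and> polar Q r x \<noteq> 0}"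
        using shift_count_singular[OF Q line(3) functional_subspace[OF fp, of p]] line(4)
        by (simp add: conj_ac)
      let ?K = "{x. polar Q p x = 0 \<and> polar Q r x = 0}"
      have "?K = ?U \<inter> {x. polar Q r x = 0}" by auto
      then have "vec.subspace ?K"
        using functional_subspace[OF fp] by (simp add: vec.subspace_inter)
      then have LK: "?L \<subseteq> ?K"
        using line pp by (intro vec.span_minimal) (auto simp: polar_sym[of Q r p])
      have "card {x. Q x = 0 \<and> polar Q p x = 0 \<and> polar Q r x = 0} \<le> card ?L"
        using False by (intro card_mono) auto
      then have 3: "?q * card {x. Q x = 0 \<and> polar Q p x = 0 \<and> polar Q r x = 0} \<le> ?q * ?q\<^sup>2"
        unfolding cL by (rule mult_le_mono2)
      have "card {x. Q x = 0} = card {x. Q x = 0 \<and> polar Q p x \<noteq> 0}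
          + card {x. Q x = 0 \<and> polar Q p x = 0 \<and> polar Q r x \<noteq> 0}
          + card {x. Q x = 0 \<and> polar Q p x = 0 \<and> polar Q r x = 0}"
        using card_split[of "{x. Q x = 0}" "\<lambda>x. polar Q p x = 0"]
          card_split[of "{x. Q x = 0 \<and> polar Q p x = 0}" "\<lambda>x. polar Q r x = 0"] by simp
      \<comment> \<open>The first two terms exhaust the complement of \<open>?K\<close>, so the
        right side is q^4 - |K| plus q times the number of zeros in \<open>?K\<close>. These zeros
        lie in \<open>?L\<close>, and \<open>?L\<close> lies in \<open>?K\<close>: at most q^2 zeros
        against at least q^2 missing vectors.\<close>
      then have "?q * card {x. Q x = 0} = card {x. polar Q p x \<noteq> 0}
          + card {x. polar Q p x = 0 \<and> polar Q r x \<noteq> 0}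
          + ?q * card {x. Q x = 0 \<and> polar Q p x = 0 \<and> polar Q r x = 0}"
        by (simp only: distrib_left 1 2)
      moreover have "?q ^ 4 = card {x. polar Q p x \<noteq> 0} + card {x. polar Q p x = 0 \<and> polar Q r x \<noteq> 0} + card ?K"
        using card_split[of "UNIV :: ('a ^ 4) set" "\<lambda>x. polar Q p x = 0"]
          card_split[of ?U "\<lambda>x. polar Q r x = 0"] by simp
      moreover have "?q\<^sup>2 \<le> card ?K" using card_mono[OF _ LK] cL by simp
      ultimately have "?q * card {x. Q x = 0} + ?q\<^sup>2 \<le> ?q ^ 4 + ?q * ?q\<^sup>2"
        using 3 by linarith
      then have "?q * (card {x. Q x = 0} + ?q) \<le> ?q * (?q ^ 3 + ?q\<^sup>2)"
        by (simp add: algebra_simps eval_nat_numeral)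
      then show thesis using that(1) q by simp
    qed
  qed
qed

text \<open>Double counting of the pairs \<open>(x, t)\<close>: if \<open>g x \<noteq> 0\<close>,
  exactly one \<open>t\<close> fits \<open>x\<close>; otherwise all \<open>t\<close> do or none
  does, according to \<open>f x\<close>.\<close>

lemma pencil_count:
  fixes f g :: "'b \<Rightarrow> 'a::{field, finite}"
  assumes S: "finite S"
  shows "(\<Sum>t\<in>UNIV. card {x \<in> S. f x + t * g x = 0}) =
    card {x \<in> S. g x \<noteq> 0} + CARD('a) * card {x \<in> S. g x = 0 \<and> f x = 0}"
proof -
  have c: "card {t. f x + t * g x = 0} = (if g x \<noteq> 0 then 1 else 0) + CARD('a) * (if g x = 0 \<and> f x = 0 then 1 else 0)" for x
  proof (cases "g x = 0")
    case False
    then have "{t. f x + t * g x = 0} = {- f x / g x}"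
      by (auto simp: field_simps add_eq_0_iff)
    then show ?thesis using False by simp
  qed auto
  have ind: "(\<Sum>x\<in>S. if P x then 1 else (0::nat)) = card {x \<in> S. P x}" for P
    using S by (simp flip: sum.inter_filter)
  have "(\<Sum>t\<in>UNIV. card {x \<in> S. f x + t * g x = 0}) = (\<Sum>x\<in>S. card {t \<in> UNIV. f x + t * g x = 0})"
    using S by (intro sum_multicount_gen) auto
  also have "\<dots> = (\<Sum>x\<in>S. if g x \<noteq> 0 then 1 else 0) + CARD('a) * (\<Sum>x\<in>S. if g x = 0 \<and> f x = 0 then 1 else 0)"
    by (simp only: c sum.distrib sum_distrib_left simp_thms mem_Collect_eq UNIV_I)
  also have "\<dots> = card {x \<in> S. g x \<noteq> 0} + CARD('a) * card {x \<in> S. g x = 0 \<and> f x = 0}"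
    by (simp only: ind)
  finally show ?thesis .
qed

section \<open>Elliptic quadrics\<close>

text \<open>The zeros of \<open>Q\<close> are counted as vectors: \<open>q\<^sup>2 + 1\<close> projective points correspond to
  \<open>(q - 1) (q\<^sup>2 + 1) + 1 = q\<^sup>3 - q\<^sup>2 + q\<close> vectors.\<close>

locale elliptic_form =
  fixes Q :: "'a::{field, finite} ^ 4 \<Rightarrow> 'a"
  assumes Q: "qform Q"
    and card_zeros: "card {x. Q x = 0} + CARD('a)\<^sup>2 = CARD('a) ^ 3 + CARD('a)"
    and nonsingular: "\<And>p. p \<noteq> 0 \<Longrightarrow> Q p = 0 \<Longrightarrow> \<exists>x. polar Q p x \<noteq> 0"
    and card_ge_3: "3 \<le> CARD('a)"
begin

text \<open>The zero vector is included: the sizes 1, q and q^2 stand for 0, 1 and q + 1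
  points.\<close>

abbreviation "section_size \<phi> \<equiv> card {x. Q x = 0 \<and> \<phi> x = 0}"

lemma functional_polar: "functional (polar Q x)"
  by (rule qform_polar(1)[OF Q])

lemma card_functional_kernel:
  fixes \<phi> :: "'a ^ 4 \<Rightarrow> 'a"
  assumes "functional \<phi>" "\<phi> u \<noteq> 0"
  shows "card {x. \<phi> x = 0} = CARD('a) ^ 3"
proof -
  have "CARD('a) * card {x \<in> UNIV. \<phi> x = 0} = CARD('a ^ 4)"
    by (rule card_kernel) (use assms in auto)
  then have "CARD('a) * card {x. \<phi> x = 0} = CARD('a) * CARD('a) ^ 3"
    unfolding card_vec4 by (simp add: eval_nat_numeral)
  then show ?thesis by simp
qed

lemma card_not_kernel:
  fixes \<phi> :: "'a ^ 4 \<Rightarrow> 'a"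
  assumes "functional \<phi>" "\<phi> u \<noteq> 0"
  shows "card {x. \<phi> x \<noteq> 0} + CARD('a) ^ 3 = CARD('a) ^ 4"
  using card_split[of "UNIV :: ('a ^ 4) set" "\<lambda>x. \<phi> x = 0"] card_functional_kernel[OF assms] by simp

text \<open>Off the tangent hyperplane at \<open>p\<close> there are (q^4 - q^3)/q = q^3 - q^2
  zeros. Of all q^3 - q^2 + q this leaves just q, which the multiples of \<open>p\<close> already
  use up.\<close>

lemma tangent_zeros:
  assumes p: "p \<noteq> 0" "Q p = 0"
  shows "{x. Q x = 0 \<and> polar Q p x = 0} = vec.span {p}"
proof -
  obtain u where u: "polar Q p u \<noteq> 0" using nonsingular p by blast
  have "CARD('a) * card {x. Q x = 0 \<and> polar Q p x \<noteq> 0} = card {x. polar Q p x \<noteq> 0}"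
    using shift_count_singular[OF Q p(2), of UNIV] by simp
  then have "CARD('a) * (card {x. Q x = 0 \<and> polar Q p x \<noteq> 0} + CARD('a)\<^sup>2) = CARD('a) * CARD('a) ^ 3"
    using card_not_kernel[OF functional_polar u] by (simp add: algebra_simps eval_nat_numeral)
  then have "card {x. Q x = 0 \<and> polar Q p x \<noteq> 0} + CARD('a)\<^sup>2 = CARD('a) ^ 3" by simp
  then have "card {x. Q x = 0 \<and> polar Q p x = 0} = CARD('a)"
    using card_split[of "{x. Q x = 0}" "\<lambda>x. polar Q p x = 0"] card_zeros by simp
  moreover have "card (vec.span {p}) = CARD('a)" using card_span_insert[of p "{}"] p by simp
  moreover have "vec.span {p} \<subseteq> {x. Q x = 0 \<and> polar Q p x = 0}"
  proof
    fix x assume "x \<in> vec.span {p}"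
    then obtain c where "x = c *s p" by (metis span_singletonE)
    then show "x \<in> {x. Q x = 0 \<and> polar Q p x = 0}"
      using p by (simp add: qform_polar(2,4)[OF Q] functional_scale[OF functional_polar])
  qed
  ultimately show ?thesis by (intro card_subset_eq[symmetric]) auto
qed

text \<open>The plane is contained in the tangent plane at \<open>p\<close> and both have q^3
  vectors, so they coincide.\<close>

lemma section_size_tangent:
  assumes p: "p \<noteq> 0" "Q p = 0" and \<phi>: "functional \<phi>" "\<phi> u \<noteq> 0"
    and tangent: "\<And>x. \<phi> x = 0 \<Longrightarrow> polar Q p x = 0"
  shows "section_size \<phi> = CARD('a)"
proof -
  obtain v where v: "polar Q p v \<noteq> 0" using nonsingular p by blast
  have "{x. \<phi> x = 0} = {x. polar Q p x = 0}"
    using tangent card_functional_kernel[OF \<phi>] card_functional_kernel[OF functional_polar v]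
    by (intro card_subset_eq) auto
  then have "{x. Q x = 0 \<and> \<phi> x = 0} = vec.span {p}" using tangent_zeros[OF p] by auto
  then show ?thesis using card_span_insert[of p "{}"] p by simp
qed

text \<open>Shifting by \<open>p\<close> within the plane gives (q^3 - q^2)/q zeros not orthogonal
  to \<open>p\<close>; the orthogonal ones are the q multiples of \<open>p\<close>.\<close>

lemma section_size_nontangent:
  assumes p: "p \<noteq> 0" "Q p = 0" and \<phi>: "functional \<phi>" "\<phi> p = 0" "\<phi> u \<noteq> 0"
    and k: "\<phi> k = 0" "polar Q p k \<noteq> 0"
  shows "section_size \<phi> = CARD('a)\<^sup>2"
proof -
  let ?U = "{x. \<phi> x = 0}"
  have "CARD('a) * card {x \<in> ?U. Q x = 0 \<and> polar Q p x \<noteq> 0} = card {x \<in> ?U. polar Q p x \<noteq> 0}"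
    using p \<phi> by (intro shift_count_singular[OF Q] functional_subspace) auto
  moreover have "CARD('a) * card {x \<in> ?U. polar Q p x = 0} = CARD('a) * CARD('a)\<^sup>2"
    using card_kernel[OF functional_subspace[OF \<phi>(1)] functional_polar, of k p] k
      card_functional_kernel[OF \<phi>(1,3)] by (simp add: eval_nat_numeral)
  moreover have "card {x \<in> ?U. polar Q p x = 0} + card {x \<in> ?U. polar Q p x \<noteq> 0} = CARD('a) ^ 3"
    using card_split[of ?U "\<lambda>x. polar Q p x = 0"] card_functional_kernel[OF \<phi>(1,3)] by simp
  ultimately have "CARD('a) * (card {x \<in> ?U. Q x = 0 \<and> polar Q p x \<noteq> 0} + CARD('a)) = CARD('a) * CARD('a)\<^sup>2"
    by (simp add: algebra_simps eval_nat_numeral)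
  then have 1: "card {x \<in> ?U. Q x = 0 \<and> polar Q p x \<noteq> 0} + CARD('a) = CARD('a)\<^sup>2" by simp
  have "vec.span {p} \<subseteq> ?U"
    using \<phi> by (intro vec.span_minimal functional_subspace) auto
  then have "{x \<in> ?U. Q x = 0 \<and> polar Q p x = 0} = vec.span {p}"
    using tangent_zeros[OF p] by auto
  then have "card {x \<in> ?U. Q x = 0 \<and> polar Q p x = 0} = CARD('a)"
    using card_span_insert[of p "{}"] p by simp
  then show ?thesis
    using 1 card_split[of "{x. Q x = 0 \<and> \<phi> x = 0}" "\<lambda>x. polar Q p x = 0"] by (simp add: conj_ac)
qed

lemma section_size_trichotomy:
  assumes \<phi>: "functional \<phi>" "\<phi> u \<noteq> 0"
  shows "section_size \<phi> \<in> {1, CARD('a), CARD('a)\<^sup>2}"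
proof (cases "\<exists>p. p \<noteq> 0 \<and> Q p = 0 \<and> \<phi> p = 0")
  case True
  then obtain p where "p \<noteq> 0" "Q p = 0" "\<phi> p = 0" by blast
  then show ?thesis
    using section_size_tangent[OF _ _ \<phi>] section_size_nontangent[of p \<phi> u] \<phi> by blast
next
  case False
  then have "{x. Q x = 0 \<and> \<phi> x = 0} = {0}"
    using functional_zero[OF \<phi>(1)] qform_zero[OF Q] by auto
  then show ?thesis by simp
qed

text \<open>The pencil of planes through the line \<open>\<phi> = 0\<close> of the tangent plane at
  \<open>p\<close>. That line misses \<open>p\<close>, hence is skew to the quadric, so its members
  share only the zero vector there. The tangent plane itself is the member at infinity, absent from
  the sum.\<close>

lemma section_pencil_sum:
  assumes p: "p \<noteq> 0" "Q p = 0" and \<phi>: "functional \<phi>" "\<phi> p \<noteq> 0"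
  shows "(\<Sum>t\<in>UNIV. section_size (\<lambda>x. \<phi> x + t * polar Q p x)) + CARD('a)\<^sup>2 = CARD('a) ^ 3 + CARD('a)"
    and "\<And>x. Q x = 0 \<Longrightarrow> polar Q p x = 0 \<Longrightarrow> \<phi> x = 0 \<Longrightarrow> x = 0"
proof -
  show zero: "x = 0" if "Q x = 0" "polar Q p x = 0" "\<phi> x = 0" for x
  proof -
    have "x \<in> vec.span {p}" using tangent_zeros[OF p] that by blast
    then obtain c where c: "x = c *s p" by (metis span_singletonE)
    then show ?thesis using that \<phi> by (simp add: functional_scale)
  qed
  have "{x. Q x = 0 \<and> polar Q p x = 0 \<and> \<phi> x = 0} = {0}"
    using zero functional_zero[OF \<phi>(1)] qform_zero[OF Q] functional_zero[OF functional_polar] by auto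
  moreover have "card {x. Q x = 0 \<and> polar Q p x = 0} = CARD('a)"
    using tangent_zeros[OF p] card_span_insert[of p "{}"] p by simp
  ultimately show "(\<Sum>t\<in>UNIV. section_size (\<lambda>x. \<phi> x + t * polar Q p x)) + CARD('a)\<^sup>2 = CARD('a) ^ 3 + CARD('a)"
    using pencil_count[of "{x. Q x = 0}" \<phi> "polar Q p"] card_zeros
      card_split[of "{x. Q x = 0}" "\<lambda>x. polar Q p x = 0"] by simp
qed

lemma pencil_member:
  assumes p: "p \<noteq> 0" "Q p = 0" and \<phi>: "functional \<phi>" "\<phi> p \<noteq> 0"
  shows "functional (\<lambda>x. \<phi> x + t * polar Q p x)" "\<phi> p + t * polar Q p p \<noteq> 0"
  using functional_comb[OF \<phi>(1) functional_polar, of 1 t p] qform_polar(4)[OF Q, of p] p \<phi> by simp_all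

lemma ex_singular: obtains p where "p \<noteq> 0" "Q p = 0"
proof -
  have "CARD('a)\<^sup>2 \<le> CARD('a) ^ 3" by (intro power_increasing) auto
  then have "card {x. Q x = 0} \<noteq> 1" using card_zeros card_ge_3 by linarith
  then have "{x. Q x = 0} \<noteq> {0}" by (metis is_singletonI is_singleton_altdef)
  then show thesis using that qform_zero[OF Q] by blast
qed

lemma ex_functional_nonzero:
  fixes p :: "'a ^ 4"
  assumes "p \<noteq> 0"
  obtains \<phi> where "functional \<phi>" "\<phi> p \<noteq> 0"
  using assms that[OF functional_component] by (auto simp: vec_eq_iff)

text \<open>No plane misses the quadric: such a plane, together with q - 1 others of size at most
  q^2, would bring the pencil sum down to q^3 - q^2 + 1, short of q^3 - q^2 + q.\<close>

lemma section_size_cases: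
  assumes \<phi>: "functional \<phi>" "\<phi> u \<noteq> 0"
  shows "section_size \<phi> = CARD('a) \<or> section_size \<phi> = CARD('a)\<^sup>2"
proof (rule ccontr)
  assume "\<not> ?thesis"
  then have 1: "section_size \<phi> = 1" using section_size_trichotomy[OF \<phi>] by auto
  have q: "CARD('a) \<le> CARD('a)\<^sup>2" by (simp add: power2_eq_square)
  obtain p where p: "p \<noteq> 0" "Q p = 0" by (rule ex_singular)
  have "\<phi> p \<noteq> 0"
  proof
    assume "\<phi> p = 0"
    then have "card {0, p} \<le> section_size \<phi>"
      using p qform_zero[OF Q] functional_zero[OF \<phi>(1)] by (intro card_mono) auto
    then show False using 1 p by simp
  qed
  let ?s = "\<lambda>t. section_size (\<lambda>x. \<phi> x + t * polar Q p x)"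
  have "?s t \<le> CARD('a)\<^sup>2" for t
    using section_size_trichotomy[OF pencil_member[OF p \<phi>(1) \<open>\<phi> p \<noteq> 0\<close>], of t] q card_ge_3 by auto
  then have "(\<Sum>t\<in>UNIV - {0}. ?s t) \<le> (CARD('a) - 1) * CARD('a)\<^sup>2"
    by (intro sum_bounded_above[THEN order_trans]) auto
  moreover have "(\<Sum>t\<in>UNIV. ?s t) = 1 + (\<Sum>t\<in>UNIV - {0}. ?s t)"
    using 1 by (simp add: sum.remove[of UNIV 0])
  moreover have "(CARD('a) - 1) * CARD('a)\<^sup>2 + CARD('a)\<^sup>2 = CARD('a) ^ 3"
    using card_ge_3 by (simp add: algebra_simps eval_nat_numeral)
  ultimately show False
    using section_pencil_sum(1)[OF p \<phi>(1) \<open>\<phi> p \<noteq> 0\<close>] card_ge_3 by linarith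
qed

lemma section_size_le:
  assumes "functional \<phi>" "\<phi> u \<noteq> 0"
  shows "section_size \<phi> \<le> CARD('a)\<^sup>2"
  using section_size_cases[OF assms] by (auto simp: power2_eq_square)

text \<open>Provides the planes that attain the minimum weight: two members of size q^2 in one
  pencil meet exactly in its axis, which is skew to the quadric.\<close>

lemma ex_extremal_pair:
  obtains \<phi> \<psi> where "functional \<phi>" "functional \<psi>" "section_size \<phi> = CARD('a)\<^sup>2"
    "section_size \<psi> = CARD('a)\<^sup>2" "\<And>x. \<phi> x = 0 \<Longrightarrow> \<psi> x = 0 \<Longrightarrow> Q x = 0 \<Longrightarrow> x = 0"
proof -
  obtain p where p: "p \<noteq> 0" "Q p = 0" by (rule ex_singular)
  obtain \<phi> where \<phi>: "functional \<phi>" "\<phi> p \<noteq> 0" using ex_functional_nonzero p by blast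
  let ?f = "\<lambda>t x. \<phi> x + t * polar Q p x"
  let ?T = "{t. section_size (?f t) = CARD('a)\<^sup>2}"
  have ind: "(\<Sum>t\<in>UNIV. if P t then 1 else (0::nat)) = card {t. P t}" for P :: "'a \<Rightarrow> bool"
    by (simp flip: sum.inter_filter)
  have "\<exists>s\<in>?T. \<exists>t\<in>?T. s \<noteq> t"
  proof (rule ccontr)
    assume "\<not> ?thesis"
    then have T: "card ?T \<le> Suc 0" unfolding card_le_Suc0_iff_eq[OF finite] by blast
    \<comment> \<open>A crude estimate, q for every member and a further q^2 for a large one,
      suffices: with at most one large member the sum is at most 2q^2, below q^3 - q^2 + q since q
      \<ge> 3.\<close>
    have "(\<Sum>t\<in>UNIV. section_size (?f t)) \<le> (\<Sum>t\<in>UNIV. CARD('a) + CARD('a)\<^sup>2 * (if section_size (?f t) = CARD('a)\<^sup>2 then 1 else 0))"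
    proof (rule sum_mono)
      fix t
      show "section_size (?f t) \<le> CARD('a) + CARD('a)\<^sup>2 * (if section_size (?f t) = CARD('a)\<^sup>2 then 1 else 0)"
        using section_size_cases[OF pencil_member[OF p \<phi>, of t]] by auto
    qed
    also have "\<dots> = CARD('a)\<^sup>2 + CARD('a)\<^sup>2 * card ?T"
      unfolding sum.distrib sum_distrib_left[symmetric] ind by (simp add: power2_eq_square)
    also have "\<dots> \<le> CARD('a)\<^sup>2 + CARD('a)\<^sup>2" using T by simp
    finally have "CARD('a) ^ 3 + CARD('a) \<le> 3 * CARD('a)\<^sup>2"
      using section_pencil_sum(1)[OF p \<phi>] by linarith
    moreover have "3 * CARD('a)\<^sup>2 \<le> CARD('a) ^ 3"
      using mult_le_mono1[OF card_ge_3, of "CARD('a)\<^sup>2"]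
      by (simp add: power2_eq_square power3_eq_cube mult.assoc)
    ultimately show False using card_ge_3 by linarith
  qed
  then obtain s t where st: "section_size (?f s) = CARD('a)\<^sup>2" "section_size (?f t) = CARD('a)\<^sup>2" "s \<noteq> t"
    by blast
  show thesis
  proof (rule that[OF pencil_member(1)[OF p \<phi>, of s] pencil_member(1)[OF p \<phi>, of t] st(1,2)])
    fix x assume *: "\<phi> x + s * polar Q p x = 0" "\<phi> x + t * polar Q p x = 0" "Q x = 0"
    then have "s * polar Q p x = t * polar Q p x" by (metis add_left_cancel)
    then have "polar Q p x = 0" using st(3) by simp
    then show "x = 0" using section_pencil_sum(2)[OF p \<phi>] * by simp
  qed
qed

lemma product_zeros:
  assumes "functional \<phi>" "functional \<psi>"
  shows "card {x. Q x = 0 \<and> \<phi> x * \<psi> x = 0} + card {x. Q x = 0 \<and> \<phi> x = 0 \<and> \<psi> x = 0}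
    = section_size \<phi> + section_size \<psi>"
proof -
  have "{x. Q x = 0 \<and> \<phi> x * \<psi> x = 0} = {x. Q x = 0 \<and> \<phi> x = 0} \<union> {x. Q x = 0 \<and> \<psi> x = 0}"
    and "{x. Q x = 0 \<and> \<phi> x = 0 \<and> \<psi> x = 0} = {x. Q x = 0 \<and> \<phi> x = 0} \<inter> {x. Q x = 0 \<and> \<psi> x = 0}"
    by auto
  then show ?thesis using card_Un_Int[of "{x. Q x = 0 \<and> \<phi> x = 0}" "{x. Q x = 0 \<and> \<psi> x = 0}"] by simp
qed

text \<open>A common zero of \<open>f\<close> and \<open>Q\<close> is a zero of every \<open>f + t Q\<close>; if there are too many of
  them, then some \<open>f + t Q\<close> exceeds the bound for forms that are not products of linear forms.\<close>

lemma common_zeros_bound: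
  assumes f: "qform f" and nz: "Q z = 0" "f z \<noteq> 0"
  obtains (small) "card {x. Q x = 0 \<and> f x = 0} + 1 < 2 * CARD('a)\<^sup>2"
  | (planes) t \<phi> \<psi> where "card {x. Q x = 0 \<and> f x = 0} + 1 = 2 * CARD('a)\<^sup>2"
      "functional \<phi>" "functional \<psi>" "\<And>x. f x + t * Q x = \<phi> x * \<psi> x"
      "section_size \<phi> = CARD('a)\<^sup>2" "section_size \<psi> = CARD('a)\<^sup>2"
      "\<And>x. \<phi> x = 0 \<Longrightarrow> \<psi> x = 0 \<Longrightarrow> Q x = 0 \<Longrightarrow> x = 0"
proof -
  let ?c = "card {x. Q x = 0 \<and> f x = 0}"
  let ?N = "\<lambda>t. card {x. f x + t * Q x = 0}"
  have qf: "qform (\<lambda>x. f x + t * Q x)" for t by (intro qform_add qform_scale f Q)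
  show thesis
  proof (cases "\<exists>t \<phi> \<psi>. functional \<phi> \<and> functional \<psi> \<and> (\<forall>x. f x + t * Q x = \<phi> x * \<psi> x)")
    case True
    then obtain t \<phi> \<psi> where fac: "functional \<phi>" "functional \<psi>" "\<And>x. f x + t * Q x = \<phi> x * \<psi> x" by blast
    have u: "\<phi> z \<noteq> 0" "\<psi> z \<noteq> 0" using fac(3)[of z] nz by auto
    let ?I = "{x. Q x = 0 \<and> \<phi> x = 0 \<and> \<psi> x = 0}"
    have "{x. Q x = 0 \<and> f x = 0} = {x. Q x = 0 \<and> \<phi> x * \<psi> x = 0}"
      using fac(3) by (metis (no_types, lifting) add.right_neutral mult_zero_right)
    then have c: "?c + card ?I = section_size \<phi> + section_size \<psi>"
      using product_zeros[OF fac(1,2)] by simp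
    have 0: "0 \<in> ?I" using qform_zero[OF Q] functional_zero fac by auto
    then have "?I \<noteq> {}" by blast
    then have I: "card ?I \<noteq> 0" unfolding card_0_eq[OF finite] .
    \<comment> \<open>By inclusion and exclusion the count is at most 2q^2 - 1, and equality
      requires both sections to be maximal and only the zero vector to be shared.\<close>
    show thesis
    proof (cases "section_size \<phi> = CARD('a)\<^sup>2 \<and> section_size \<psi> = CARD('a)\<^sup>2 \<and> card ?I = 1")
      case True
      then have "?I = {0}" using 0 by (metis (lifting) card_1_singletonE singletonD)
      then have "x = 0" if "\<phi> x = 0" "\<psi> x = 0" "Q x = 0" for x using that by auto
      moreover have "?c + 1 = 2 * CARD('a)\<^sup>2" using True c by linarith
      ultimately show thesis using planes[OF _ fac] True by blast
    next
      case False
      then show thesis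
        using small c I section_size_le[OF fac(1) u(1)] section_size_le[OF fac(2) u(2)] by linarith
    qed
  next
    case False
    have "?N t + CARD('a) \<le> CARD('a) ^ 3 + CARD('a)\<^sup>2" for t
    proof (rule qform_zeros_bound[OF qf[of t]])
      fix \<phi> \<psi> assume "functional \<phi>" "functional \<psi>" "\<And>x. f x + t * Q x = \<phi> x * \<psi> x"
      then show ?thesis using False by blast
    qed
    then have "(\<Sum>t\<in>UNIV. ?N t + CARD('a)) \<le> CARD('a) * (CARD('a) ^ 3 + CARD('a)\<^sup>2)"
      using sum_bounded_above[of UNIV "\<lambda>t. ?N t + CARD('a)"] by simp
    then have "(\<Sum>t\<in>UNIV. ?N t) + CARD('a)\<^sup>2 \<le> CARD('a) ^ 4 + CARD('a) ^ 3"
      by (simp add: sum.distrib algebra_simps eval_nat_numeral)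
    moreover have "(\<Sum>t\<in>UNIV. ?N t) = card {x. Q x \<noteq> 0} + CARD('a) * ?c"
      using pencil_count[of "UNIV :: ('a ^ 4) set" f Q] by simp
    moreover have "card {x. Q x = 0} + card {x. Q x \<noteq> 0} = CARD('a) ^ 4"
      using card_split[of "UNIV :: ('a ^ 4) set" "\<lambda>x. Q x = 0"] by simp
    \<comment> \<open>Here \<open>card {x. Q x \<noteq> 0}\<close> is q^4 - q^3 + q^2 - q. Division
      by q then leaves c + 2q \<le> 2q^2 + 1, strictly below the value 2q^2 - 1 of two
      planes.\<close>
    ultimately have "CARD('a) * ?c + 2 * CARD('a)\<^sup>2 \<le> 2 * CARD('a) ^ 3 + CARD('a)"
      using card_zeros by linarith
    then have "CARD('a) * (?c + 2 * CARD('a)) \<le> CARD('a) * (2 * CARD('a)\<^sup>2 + 1)"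
      by (simp add: algebra_simps eval_nat_numeral)
    then have "?c + 2 * CARD('a) \<le> 2 * CARD('a)\<^sup>2 + 1" by (subst (asm) mult_le_cancel1) simp
    then show thesis using small card_ge_3 by linarith
  qed
qed

end

section \<open>Lines and reguli\<close>

lemma card_proj_points_subspace:
  fixes W :: "('a::{field, finite} ^ 4) set"
  assumes "vec.subspace W"
  shows "(CARD('a) - 1) * card (proj_points \<inter> W) + 1 = CARD('a) ^ vec.dim W"
  using card_zero_set_cone[of W] card_subspace[OF assms] assms
  by (simp add: vec.subspace_0 vec.subspace_scale)

lemma card_proj_line:
  fixes l :: "('a::{field, finite} ^ 4) set"
  assumes "l \<in> proj_lines"
  shows "card l = CARD('a) + 1"
proof -
  obtain W where W: "l = proj_points \<inter> W" "vec.subspace W" "vec.dim W = 2"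
    using assms by (auto simp: proj_lines_def)
  \<comment> \<open>Turns the truncated difference q - 1 into the positive factor
    \<open>Suc n\<close>, which can be cancelled.\<close>
  obtain n where n: "CARD('a) = Suc (Suc n)"
    using card_field_ge_2[where 'a = 'a] by (metis add_2_eq_Suc le_Suc_ex)
  have "Suc n * card l + 1 = Suc n * (CARD('a) + 1) + 1"
    using card_proj_points_subspace[OF W(2)] W by (simp add: n power2_eq_square)
  then have "Suc n * card l = Suc n * (CARD('a) + 1)" by linarith
  then show ?thesis by (simp only: mult_cancel1) simp
qed

lemma line_eq_span:
  fixes W :: "('a::{field, finite} ^ 4) set"
  assumes "vec.subspace W" "vec.dim W = 2" "u \<in> proj_points \<inter> W" "v \<in> proj_points \<inter> W" "u \<noteq> v"
  shows "W = vec.span {u, v}"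
proof -
  have nz: "u \<noteq> 0" "v \<noteq> 0" using assms by (auto simp: proj_points_def)
  have "u \<notin> vec.span {v}"
  proof
    assume "u \<in> vec.span {v}"
    then obtain c where c: "u = c *s v" by (rule span_singletonE)
    then show False
      using proj_points_multiple_unique[of u v 1 c] assms by simp
  qed
  then have "card (vec.span {u, v}) = CARD('a)\<^sup>2"
    using card_span_insert[of u "{v}"] card_span_insert[of v "{}"] nz by (simp add: power2_eq_square)
  then have "card (vec.span {u, v}) = card W" using card_subspace assms by metis
  moreover have "vec.span {u, v} \<subseteq> W" using assms by (intro vec.span_minimal) auto
  ultimately show ?thesis by (intro card_subset_eq[symmetric]) auto
qed

lemma proj_lines_eq:
  fixes l m :: "('a::{field, finite} ^ 4) set"
  assumes "l \<in> proj_lines" "m \<in> proj_lines" "u \<in> l" "v \<in> l" "u \<in> m" "v \<in> m" "u \<noteq> v"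
  shows "l = m"
proof -
  obtain V where V: "l = proj_points \<inter> V" "vec.subspace V" "vec.dim V = 2"
    using assms by (auto simp: proj_lines_def)
  obtain W where W: "m = proj_points \<inter> W" "vec.subspace W" "vec.dim W = 2"
    using assms by (auto simp: proj_lines_def)
  show ?thesis
    using line_eq_span[OF V(2,3), of u v] line_eq_span[OF W(2,3), of u v] V W assms by blast
qed

text \<open>Pigeonhole: the q^4 pairs from \<open>L\<close> and \<open>M\<close> have at most q^3
  differences, and a collision x - y = x' - y' gives the nonzero common vector x - x' = y -
  y'.\<close>

lemma coplanar_lines_meet:
  fixes L M U :: "('a::{field, finite} ^ 4) set"
  assumes L: "vec.subspace L" "vec.dim L = 2" and M: "vec.subspace M" "vec.dim M = 2"
    and U: "vec.subspace U" "card U \<le> CARD('a) ^ 3" "L \<subseteq> U" "M \<subseteq> U"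
  shows "proj_points \<inter> L \<inter> M \<noteq> {}"
proof -
  have "\<not> inj_on (\<lambda>(x, y). x - y) (L \<times> M)"
  proof
    assume "inj_on (\<lambda>(x, y). x - y) (L \<times> M)"
    then have "card (L \<times> M) \<le> card U"
      using U by (intro card_inj_on_le[of "\<lambda>(x, y). x - y"]) (auto intro: vec.subspace_diff)
    then have "CARD('a) ^ 4 \<le> CARD('a) ^ 3"
      using card_subspace[OF L(1)] card_subspace[OF M(1)] L M U
      by (simp add: card_cartesian_product flip: power_add)
    then show False
      using card_field_ge_2[where 'a = 'a] by (simp add: power_le_imp_le_exp)
  qed
  then obtain x y x' y' where *: "x \<in> L" "x' \<in> L" "y \<in> M" "y' \<in> M" "x - y = x' - y'" "(x, y) \<noteq> (x', y')"
    by (auto simp: inj_on_def)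
  then have eq: "x - x' = y - y'" by (simp add: algebra_simps)
  then have "x - x' \<noteq> 0" using * by auto
  then obtain c where c: "c *s (x - x') \<in> proj_points" using proj_points_multiple_exists by blast
  have "c *s (x - x') \<in> L" using * L by (simp add: vec.subspace_diff vec.subspace_scale)
  moreover have "c *s (x - x') \<in> M"
    unfolding eq using * M by (simp add: vec.subspace_diff vec.subspace_scale)
  ultimately show ?thesis using c by blast
qed

text \<open>Two intersecting transversals span a plane containing at least two of the three skew lines.\<close>

lemma regulus_disjoint:
  fixes R :: "('a::{field, finite} ^ 4) set set"
  assumes R: "regulus R" and m: "m \<in> R" "m' \<in> R" "m \<noteq> m'"
  shows "m \<inter> m' = {}"
proof (rule ccontr)
  assume "m \<inter> m' \<noteq> {}"
  then obtain p where p: "p \<in> m" "p \<in> m'" by blast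
  obtain l1 l2 l3 where l: "l1 \<in> proj_lines" "l2 \<in> proj_lines" "l3 \<in> proj_lines"
    and skew: "l1 \<inter> l2 = {}" "l1 \<inter> l3 = {}" "l2 \<inter> l3 = {}"
    and R_def: "R = {m \<in> proj_lines. m \<inter> l1 \<noteq> {} \<and> m \<inter> l2 \<noteq> {} \<and> m \<inter> l3 \<noteq> {}}"
    using R by (auto simp: regulus_def)
  have pl: "m \<in> proj_lines" "m' \<in> proj_lines" using m R_def by auto
  obtain M where M: "m = proj_points \<inter> M" "vec.subspace M" "vec.dim M = 2"
    using pl by (auto simp: proj_lines_def)
  obtain M' where M': "m' = proj_points \<inter> M'" "vec.subspace M'" "vec.dim M' = 2"
    using pl by (auto simp: proj_lines_def)
  have other: "\<exists>a\<in>l. a \<noteq> p" if "l \<in> proj_lines" for l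
  proof (rule ccontr)
    assume "\<not> ?thesis"
    then have "card l \<le> card {p}" by (intro card_mono) auto
    then show False using card_proj_line[OF that] by simp
  qed
  obtain a where a: "a \<in> m" "a \<noteq> p" using other pl by blast
  obtain b where b: "b \<in> m'" "b \<noteq> p" using other pl by blast
  let ?U = "vec.span {p, a, b}"
  have MU: "M \<subseteq> ?U" "M' \<subseteq> ?U"
    using line_eq_span[OF M(2,3), of p a] line_eq_span[OF M'(2,3), of p b] M M' a b p
      vec.span_mono[of "{p, a}" "{p, a, b}"] vec.span_mono[of "{p, b}" "{p, a, b}"] by auto
  have "card (vec.span {b}) \<le> CARD('a)" using card_span_insert_le[of b "{}"] by simp
  then have "CARD('a) * card (vec.span {b}) \<le> CARD('a) * CARD('a)" by (rule mult_le_mono2)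
  then have "card (vec.span {a, b}) \<le> CARD('a) * CARD('a)"
    using card_span_insert_le[of a "{b}"] by (rule order_trans[rotated])
  then have "CARD('a) * card (vec.span {a, b}) \<le> CARD('a) * (CARD('a) * CARD('a))" by (rule mult_le_mono2)
  then have U: "card ?U \<le> CARD('a) ^ 3"
    using card_span_insert_le[of p "{a, b}"] unfolding power3_eq_cube mult.assoc by (rule order_trans[rotated])
  \<comment> \<open>A line that avoids \<open>p\<close> meets \<open>m\<close> and \<open>m'\<close>
    in different points, since these two share only \<open>p\<close>; it therefore lies in their
    plane.\<close>
  have in_U: "\<exists>L. l = proj_points \<inter> L \<and> vec.subspace L \<and> vec.dim L = 2 \<and> L \<subseteq> ?U"
    if l: "l \<in> proj_lines" "m \<inter> l \<noteq> {}" "m' \<inter> l \<noteq> {}" "p \<notin> l" for l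
  proof -
    obtain L where L: "l = proj_points \<inter> L" "vec.subspace L" "vec.dim L = 2"
      using l by (auto simp: proj_lines_def)
    obtain c d where cd: "c \<in> m" "c \<in> l" "d \<in> m'" "d \<in> l" using l by blast
    have "c \<noteq> d"
    proof
      assume "c = d"
      then have "m = m'" using proj_lines_eq[OF pl, of p c] cd p l(4) by blast
      then show False using m by blast
    qed
    then have "L = vec.span {c, d}" using line_eq_span[OF L(2,3)] cd L by blast
    also have "\<dots> \<subseteq> ?U"
      using cd M M' MU by (intro vec.span_minimal) auto
    finally show ?thesis using L by blast
  qed
  have meet: "l \<inter> l' \<noteq> {}" if ll: "l \<in> {l1, l2, l3}" "l' \<in> {l1, l2, l3}" "p \<notin> l" "p \<notin> l'" for l l'
  proof -
    have "l \<in> proj_lines" "m \<inter> l \<noteq> {}" "m' \<inter> l \<noteq> {}" "l' \<in> proj_lines" "m \<inter> l' \<noteq> {}" "m' \<inter> l' \<noteq> {}"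
      using ll m l R_def by auto
    then obtain L L' where "l = proj_points \<inter> L" "vec.subspace L" "vec.dim L = 2" "L \<subseteq> ?U"
      "l' = proj_points \<inter> L'" "vec.subspace L'" "vec.dim L' = 2" "L' \<subseteq> ?U"
      using in_U ll(3,4) by meson
    then show ?thesis
      using coplanar_lines_meet[of L L' ?U] U by blast
  qed
  \<comment> \<open>At most one of the three skew lines passes through \<open>p\<close>; the other
    two lie in one plane and would have to meet.\<close>
  show False
    using meet[of l1 l2] meet[of l1 l3] meet[of l2 l3] skew by blast
qed

text \<open>Disjointness is demanded only on \<open>X\<close>: the lines of a cone share the vertex,
  which is off \<open>X\<close>.\<close>

lemma card_union_bisecants:
  fixes X :: "('a::{field, finite} ^ 4) set"
  assumes "\<And>l m. l \<in> L \<Longrightarrow> m \<in> L \<Longrightarrow> l \<noteq> m \<Longrightarrow> l \<inter> m \<inter> X = {}" "\<forall>l\<in>L. bisecant X l"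
  shows "card (\<Union>L \<inter> X) = 2 * card L"
proof -
  have "\<Union>L \<inter> X = (\<Union>l\<in>L. l \<inter> X)" by blast
  also have "card \<dots> = (\<Sum>l\<in>L. card (l \<inter> X))"
    using assms(1) by (intro card_UN_disjoint) auto
  also have "\<dots> = (\<Sum>l\<in>L. 2)" using assms(2) by (intro sum.cong) (auto simp: bisecant_def)
  finally show ?thesis by simp
qed

lemma cone_type_card:
  fixes X :: "('a::{field, finite} ^ 4) set"
  assumes "cone_type X S"
  shows "card (S \<inter> X) = 2 * CARD('a) + 2"
proof -
  obtain v L where L: "v \<notin> X" "\<forall>l\<in>L. bisecant X l" "L \<subseteq> proj_lines" "card L = CARD('a) + 1"
    "\<forall>l\<in>L. v \<in> l" "S = \<Union>L"
    using assms by (auto simp: cone_type_def vertex_and_lines_def)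
  have "l \<inter> m \<inter> X = {}" if "l \<in> L" "m \<in> L" "l \<noteq> m" for l m
    using proj_lines_eq[of l m v] that L by blast
  from card_union_bisecants[OF this L(2)] show ?thesis using L by simp
qed

text \<open>The number of lines in the regulus is derived rather than assumed: pairwise disjoint
  lines of q + 1 points each partition (q + 1)^2 points.\<close>

lemma hyperbolic_type_card:
  fixes X :: "('a::{field, finite} ^ 4) set"
  assumes "hyperbolic_type X S"
  shows "card (S \<inter> X) = 2 * CARD('a) + 2"
proof -
  obtain R where R: "regulus R" "\<Union>R = S" "\<forall>l\<in>R. bisecant X l" and S: "card S = (CARD('a) + 1)\<^sup>2"
    using assms by (auto simp: hyperbolic_type_def hyperbolic_quadric_def)
  have lines: "R \<subseteq> proj_lines" using R(1) by (auto simp: regulus_def)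
  have "card S = (\<Sum>l\<in>R. card l)"
    unfolding R(2)[symmetric] using regulus_disjoint[OF R(1)]
    by (intro card_Union_disjoint) (auto simp: pairwise_def disjnt_def)
  also have "\<dots> = card R * (CARD('a) + 1)"
    using lines card_proj_line by (subst sum.cong[OF refl, of _ _ "\<lambda>_. CARD('a) + 1"]) auto
  finally have "card R * (CARD('a) + 1) = (CARD('a) + 1) * (CARD('a) + 1)"
    using S by (simp only: power2_eq_square)
  then have "card R = CARD('a) + 1" by (simp only: mult_cancel2) simp
  moreover have "l \<inter> m \<inter> X = {}" if "l \<in> R" "m \<in> R" "l \<noteq> m" for l m
    using regulus_disjoint[OF R(1) that] by blast
  from card_union_bisecants[OF this R(3)] have "card (S \<inter> X) = 2 * card R" using R(2) by simp
  ultimately show ?thesis by simp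
qed

section \<open>Plane sections\<close>

text \<open>The columns of \<open>A\<close> are a basis of \<open>W\<close>; injectivity follows
  because domain and range have equal finite size.\<close>

lemma subspace_parametrization:
  fixes W :: "('a::{field, finite} ^ 4) set"
  assumes W: "vec.subspace W" "vec.dim W = 3"
  obtains A :: "'a ^ 3 ^ 4" where "inj ((*v) A)" "range ((*v) A) = W"
proof -
  obtain B where B: "B \<subseteq> W" "vec.independent B" "W \<subseteq> vec.span B" "card B = 3"
    using vec.basis_exists[of W] W(2) by metis
  obtain b :: "3 \<Rightarrow> 'a ^ 4" where b: "bij_betw b UNIV B"
    using finite_same_card_bij[of "UNIV :: 3 set" B] B(4) by auto
  define A :: "'a ^ 3 ^ 4" where "A = (\<chi> r c. b c $ r)"
  have A: "A *v x = (\<Sum>c\<in>UNIV. x $ c *s b c)" for x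
    by (simp add: A_def matrix_vector_mult_def vec_eq_iff mult.commute)
  have bB: "b c \<in> B" for c using b by (auto simp: bij_betw_def)
  have "range ((*v) A) \<subseteq> W"
    using B(1) W(1) bB by (auto simp: A intro!: vec.subspace_sum vec.subspace_scale)
  moreover have "W \<subseteq> range ((*v) A)"
  proof -
    have "vec.span B \<subseteq> range ((*v) A)"
    proof (rule vec.span_minimal)
      show "vec.subspace (range ((*v) A))"
        by (intro vec.subspace_image vec.subspace_UNIV)
      show "B \<subseteq> range ((*v) A)"
      proof
        fix v assume "v \<in> B"
        then obtain c where "v = b c" using b by (auto simp: bij_betw_def)
        then have "v = A *v axis c 1"
          by (simp add: A axis_def if_distrib[of "\<lambda>t. t *s _"] cong: if_cong)
        then show "v \<in> range ((*v) A)" by blast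
      qed
    qed
    then show ?thesis using B(3) by blast
  qed
  ultimately have range: "range ((*v) A) = W" by blast
  have "card (range ((*v) A)) = card (UNIV :: ('a ^ 3) set)"
    unfolding range card_subspace[OF W(1)] W(2) by simp
  then have "inj ((*v) A)" by (intro eq_card_imp_inj_on) auto
  then show thesis using that range by blast
qed

text \<open>A functional killing the three columns of \<open>A\<close> vanishes on the range, and
  both sets have q^3 elements.\<close>

lemma range_eq_kernel:
  fixes A :: "'a::{field, finite} ^ 3 ^ 4"
  assumes inj: "inj ((*v) A)"
  obtains \<phi> u where "functional \<phi>" "\<phi> u = 1" "{x. \<phi> x = 0} = range ((*v) A)"
proof -
  obtain \<phi> u where \<phi>: "functional \<phi>" "\<phi> u = 1"
    "\<phi> (A *v axis 1 1) = 0" "\<phi> (A *v axis 2 1) = 0" "\<phi> (A *v axis 3 1) = 0"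
    by (rule exists_functional_vanishing)
  have "functional (\<lambda>y. \<phi> (A *v y))"
    using \<phi>(1) by (simp add: functional_def matrix_vector_right_distrib vec.scale)
  then have "\<phi> (A *v y) = (\<Sum>i\<in>UNIV. y $ i * \<phi> (A *v axis i 1))" for y
    by (rule functional_basis)
  also have "(\<Sum>i\<in>UNIV. y $ i * \<phi> (A *v axis i 1)) = 0" for y
    unfolding UNIV_3 using \<phi>(3-5) by simp
  finally have "\<phi> (A *v y) = 0" for y .
  then have sub: "range ((*v) A) \<subseteq> {x. \<phi> x = 0}" by auto
  have "CARD('a) * card {x \<in> UNIV. \<phi> x = 0} = CARD('a ^ 4)"
    by (rule card_kernel[of _ _ u]) (use \<phi> in auto)
  then have "CARD('a) * card {x. \<phi> x = 0} = CARD('a) * CARD('a) ^ 3"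
    unfolding card_vec4 by (simp add: eval_nat_numeral)
  then have "card (range ((*v) A)) = card {x. \<phi> x = 0}"
    using card_image[OF inj] by simp
  then have "{x. \<phi> x = 0} = range ((*v) A)"
    using card_subset_eq[OF _ sub] by simp
  then show thesis using that \<phi> by blast
qed

context elliptic_form
begin

abbreviation "quadric \<equiv> {x \<in> proj_points. Q x = 0}"

lemma card_common_zeros:
  assumes "f 0 = 0" "\<And>c x. f x = 0 \<Longrightarrow> f (c *s x) = 0"
  shows "card {x. Q x = 0 \<and> f x = 0} = (CARD('a) - 1) * card {x \<in> quadric. f x = 0} + 1"
proof -
  have "proj_points \<inter> {x. Q x = 0 \<and> f x = 0} = {x \<in> quadric. f x = 0}" by blast
  then show ?thesis
    using card_zero_set_cone[of "{x. Q x = 0 \<and> f x = 0}"] assms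
    by (simp add: qform_zero[OF Q] qform_polar(2)[OF Q])
qed

lemma square_section_card:
  assumes "functional \<phi>" "section_size \<phi> = CARD('a)\<^sup>2"
  shows "card {x \<in> quadric. \<phi> x = 0} = CARD('a) + 1"
proof -
  obtain n where n: "CARD('a) = Suc (Suc n)"
    using card_field_ge_2[where 'a = 'a] by (metis add_2_eq_Suc le_Suc_ex)
  have "Suc n * card {x \<in> quadric. \<phi> x = 0} + 1 = Suc n * (CARD('a) + 1) + 1"
    using card_common_zeros[of \<phi>] assms
    by (simp add: functional_zero[OF assms(1)] functional_scale[OF assms(1)] n power2_eq_square)
  then have "Suc n * card {x \<in> quadric. \<phi> x = 0} = Suc n * (CARD('a) + 1)" by linarith
  then show ?thesis by (simp only: mult_cancel1) simp
qed

text \<open>The conic is \<open>Q\<close> pulled back along a parametrization of the plane. A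
  radical vector of the pullback would map to a singular point whose tangent plane is this plane,
  forcing size q.\<close>

lemma section_non_tangent:
  assumes \<phi>: "functional \<phi>" "\<phi> u \<noteq> 0" and size: "section_size \<phi> = CARD('a)\<^sup>2"
  shows "non_tangent_plane quadric (proj_points \<inter> {x. \<phi> x = 0})"
proof -
  let ?W = "{x. \<phi> x = 0}" let ?P = "proj_points \<inter> ?W"
  have W: "vec.subspace ?W" using \<phi>(1) by (rule functional_subspace)
  have "CARD('a) ^ vec.dim ?W = CARD('a) ^ 3"
    using card_subspace[OF W] card_functional_kernel[OF \<phi>] by simp
  then have dim: "vec.dim ?W = 3" using card_ge_3 by (subst (asm) power_inject_exp) auto
  obtain A :: "'a ^ 3 ^ 4" where A: "inj ((*v) A)" "range ((*v) A) = ?W"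
    using subspace_parametrization[OF W dim] by blast
  obtain g where g: "g \<in> quadratic_forms" "poly_eval g = (\<lambda>y. Q (A *v y))"
    using qform_poly[OF qform_compose[OF Q]] by blast
  have rank: "form_rank g = 3"
  proof (rule ccontr)
    assume "form_rank g \<noteq> 3"
    then have "form_rank g < CARD(3)" using form_rank_le[of g] by simp
    then obtain v where v: "v \<noteq> 0" "\<And>y c. poly_eval g (y + c *s v) = poly_eval g y"
      using form_rank_less_radical by blast
    have inv: "Q (A *v y + A *v v) = Q (A *v y)" for y
      using v(2)[of y 1] by (simp add: g(2) matrix_vector_right_distrib)
    have Qv: "Q (A *v v) = 0" using inv[of 0] by (simp add: qform_zero[OF Q])
    have "A *v v \<noteq> 0" using v(1) A(1) by (metis injD matrix_vector_mult_0_right)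
    moreover have "polar Q (A *v v) x = 0" if "\<phi> x = 0" for x
    proof -
      have "x \<in> range ((*v) A)" using that A(2) by blast
      then obtain y where "x = A *v y" by blast
      then show ?thesis using inv[of y] Qv by (simp add: polar_def add.commute)
    qed
    ultimately have "section_size \<phi> = CARD('a)"
      using section_size_tangent[OF _ Qv \<phi>] by blast
    then show False using size card_ge_3 by (simp add: power2_eq_square)
  qed
  have nonzero: "g \<noteq> 0"
  proof
    assume "g = 0"
    have "Q x = 0" if "\<phi> x = 0" for x
    proof -
      have "x \<in> range ((*v) A)" using that A(2) by blast
      then obtain y where "x = A *v y" by blast
      then show ?thesis using fun_cong[OF g(2), of y] \<open>g = 0\<close> by simp
    qed
    then have "{x. Q x = 0 \<and> \<phi> x = 0} = ?W" by blast
    then have "CARD('a) ^ 3 = CARD('a) ^ 2" using size card_functional_kernel[OF \<phi>] by simp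
    then show False using card_ge_3 by (subst (asm) power_inject_exp) auto
  qed
  have "?P \<inter> quadric = {x \<in> proj_points. \<exists>y. x = A *v y \<and> poly_eval g y = 0}"
    unfolding g(2) A(2)[symmetric] by auto
  then have "conic_in ?P (?P \<inter> quadric)"
    unfolding conic_in_def A(2)[symmetric]
    by (intro exI[of _ A] exI[of _ g] conjI A(1) g(1) rank nonzero refl)
  moreover have "?P \<in> proj_planes" unfolding proj_planes_def using W dim by blast
  ultimately show ?thesis by (simp add: non_tangent_plane_def)
qed

text \<open>A tangent section has only \<open>q\<close> zeros, whereas a ternary form of rank 3 with a zero has at
  least \<open>q\<^sup>2 - q\<close> of them.\<close>

lemma non_tangent_section:
  assumes "non_tangent_plane quadric P"
  shows "card (P \<inter> quadric) = CARD('a) + 1"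
proof -
  have "conic_in P (P \<inter> quadric)" using assms by (simp add: non_tangent_plane_def)
  then obtain A :: "'a ^ 3 ^ 4" and g :: "('a, 3) mpoly" where A: "inj ((*v) A)" "P = proj_points \<inter> range ((*v) A)"
    and g: "g \<in> quadratic_forms" "form_rank g = 3"
    and C: "P \<inter> quadric = {x \<in> proj_points. \<exists>y. x = A *v y \<and> poly_eval g y = 0}"
    unfolding conic_in_def by (elim exE conjE) (rule that)
  obtain \<phi> u where \<phi>: "functional \<phi>" "\<phi> u = 1" "{x. \<phi> x = 0} = range ((*v) A)"
    using range_eq_kernel[OF A(1)] by blast
  have \<phi>u: "\<phi> u \<noteq> 0" using \<phi>(2) by simp
  have PX: "P \<inter> quadric = {x \<in> quadric. \<phi> x = 0}" unfolding A(2) \<phi>(3)[symmetric] by blast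
  show ?thesis
  proof (cases "section_size \<phi> = CARD('a)\<^sup>2")
    case True
    then show ?thesis unfolding PX by (rule square_section_card[OF \<phi>(1)])
  next
    case False
    then have size: "section_size \<phi> = CARD('a)" using section_size_cases[OF \<phi>(1) \<phi>u] by blast
    have qg: "qform (poly_eval g)" by (rule poly_eval_qform[OF g(1)])
    \<comment> \<open>A conic is given only by its normalized points, so \<open>g\<close> and the
      pullback of \<open>Q\<close> are known to agree merely in their zeros; homogeneity extends
      this to all vectors.\<close>
    have zeros: "poly_eval g y = 0 \<longleftrightarrow> Q (A *v y) = 0" for y
    proof (cases "y = 0")
      case True
      then show ?thesis by (simp add: qform_zero[OF Q] qform_zero[OF qg])
    next
      case False
      then have "A *v y \<noteq> 0" using A(1) by (metis injD matrix_vector_mult_0_right)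
      then obtain c where c: "c \<noteq> 0" "c *s (A *v y) \<in> proj_points"
        using proj_points_multiple_exists by blast
      let ?x = "A *v (c *s y)"
      have x: "?x \<in> proj_points" using c(2) by (simp add: vec.scale)
      have "Q ?x = 0 \<longleftrightarrow> ?x \<in> P \<inter> quadric" using x A(2) by blast
      also have "\<dots> \<longleftrightarrow> poly_eval g (c *s y) = 0"
        unfolding C using x A(1) by (auto dest: injD)
      finally show ?thesis
        using c(1) by (simp add: vec.scale qform_polar(2)[OF Q] qform_polar(2)[OF qg])
    qed
    have "(*v) A ` {y. poly_eval g y = 0} = {x. Q x = 0 \<and> \<phi> x = 0}"
    proof (intro set_eqI iffI)
      fix x assume "x \<in> (*v) A ` {y. poly_eval g y = 0}"
      then show "x \<in> {x. Q x = 0 \<and> \<phi> x = 0}" using zeros \<phi>(3) by blast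
    next
      fix x assume x: "x \<in> {x. Q x = 0 \<and> \<phi> x = 0}"
      then have "x \<in> range ((*v) A)" using \<phi>(3) by blast
      then show "x \<in> (*v) A ` {y. poly_eval g y = 0}" using x zeros by blast
    qed
    then have card_g: "card {y. poly_eval g y = 0} = CARD('a)"
      using card_image[OF inj_on_subset[OF A(1) subset_UNIV], of "{y. poly_eval g y = 0}"] size by simp
    have "{y. poly_eval g y = 0} \<noteq> {0}"
    proof
      assume "{y. poly_eval g y = 0} = {0}"
      then have "card {y. poly_eval g y = 0} = 1" by simp
      then show False using card_g card_ge_3 by simp
    qed
    then obtain y where y: "y \<noteq> 0" "poly_eval g y = 0" using qform_zero[OF qg] by blast
    have "\<exists>z. polar (poly_eval g) y z \<noteq> 0"
    proof (rule ccontr)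
      assume "\<not> ?thesis"
      then have "poly_eval g (x + y) = poly_eval g x" for x
        using y(2) by (simp add: polar_def add.commute)
      then show False using radical_form_rank_less[OF g(1) y(1)] g(2) by simp
    qed
    then obtain z where z: "polar (poly_eval g) y z \<noteq> 0" by blast
    have "CARD('a) * card {x \<in> UNIV. polar (poly_eval g) y x = 0} = CARD('a ^ 3)"
      by (rule card_kernel[of _ _ z]) (use z qform_polar(1)[OF qg] in auto)
    then have "CARD('a) * card {x. polar (poly_eval g) y x = 0} = CARD('a) * CARD('a)\<^sup>2"
      by (simp add: power2_eq_square power3_eq_cube)
    then have "card {x. polar (poly_eval g) y x = 0} = CARD('a)\<^sup>2" by simp
    moreover have "CARD('a ^ 3) = card {x. polar (poly_eval g) y x = 0} + card {x. polar (poly_eval g) y x \<noteq> 0}"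
      using card_split[of "UNIV :: ('a ^ 3) set" "\<lambda>x. polar (poly_eval g) y x = 0"] by simp
    moreover have "CARD('a) * card {x. poly_eval g x = 0 \<and> polar (poly_eval g) y x \<noteq> 0}
        = card {x. polar (poly_eval g) y x \<noteq> 0}"
      using shift_count_singular[OF qg y(2), of UNIV] by simp
    moreover have "card {x. poly_eval g x = 0 \<and> polar (poly_eval g) y x \<noteq> 0} \<le> CARD('a)"
      unfolding card_g[symmetric] by (intro card_mono) auto
    then have "CARD('a) * card {x. poly_eval g x = 0 \<and> polar (poly_eval g) y x \<noteq> 0} \<le> CARD('a)\<^sup>2"
      by (simp add: power2_eq_square)
    \<comment> \<open>The q^3 - q^2 vectors not orthogonal to \<open>y\<close> are q times the
      number of zeros among them, hence at most q^2; this contradicts q \<ge> 3.\<close>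
    ultimately have "CARD('a) ^ 3 \<le> 2 * CARD('a)\<^sup>2" by simp
    moreover have "3 * CARD('a)\<^sup>2 \<le> CARD('a) ^ 3"
      using mult_le_mono1[OF card_ge_3, of "CARD('a)\<^sup>2"]
      by (simp add: power2_eq_square power3_eq_cube mult.assoc)
    ultimately have "CARD('a)\<^sup>2 = 0" by linarith
    then show ?thesis by simp
  qed
qed

lemma two_planes_type_card:
  assumes "two_planes_type quadric S"
  shows "card (S \<inter> quadric) = 2 * CARD('a) + 2"
proof -
  obtain P1 P2 where P: "non_tangent_plane quadric P1" "non_tangent_plane quadric P2" "S = P1 \<union> P2"
    "P1 \<inter> P2 \<inter> quadric = {}"
    using assms by (auto simp: two_planes_type_def skew_to_def)
  have "card (S \<inter> quadric) = card (P1 \<inter> quadric) + card (P2 \<inter> quadric)"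
    unfolding P(3) Int_Un_distrib2 using P(4) by (intro card_Un_disjoint) auto
  then show ?thesis using P(1,2) by (simp add: non_tangent_section)
qed

section \<open>Weights\<close>

lemma card_quadric: "card quadric = CARD('a)\<^sup>2 + 1"
proof -
  obtain n where n: "CARD('a) = Suc (Suc n)"
    using card_field_ge_2[where 'a = 'a] by (metis add_2_eq_Suc le_Suc_ex)
  have "card {x. Q x = 0} = Suc n * card quadric + 1"
    using card_common_zeros[of "\<lambda>_. 0"] by (simp add: n)
  then have "Suc n * card quadric = Suc n * (CARD('a)\<^sup>2 + 1)"
    using card_zeros by (simp add: n power2_eq_square power3_eq_cube)
  then show ?thesis by (simp only: mult_cancel1) simp
qed

lemma weight_codeword:
  "weight quadric (codeword quadric f) + card (zero_set f \<inter> quadric) = CARD('a)\<^sup>2 + 1"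
proof -
  have "{x \<in> quadric. codeword quadric f x \<noteq> 0} = {x \<in> quadric. poly_eval f x \<noteq> 0}"
    by (auto simp: codeword_def)
  moreover have "zero_set f \<inter> quadric = {x \<in> quadric. poly_eval f x = 0}"
    by (auto simp: zero_set_def)
  ultimately show ?thesis
    using card_split[of quadric "\<lambda>x. poly_eval f x = 0"] card_quadric by (simp add: weight_def)
qed

lemma card_zero_set_common:
  assumes "f \<in> quadratic_forms"
  shows "card {x. Q x = 0 \<and> poly_eval f x = 0} = (CARD('a) - 1) * card (zero_set f \<inter> quadric) + 1"
proof -
  have "zero_set f \<inter> quadric = {x \<in> quadric. poly_eval f x = 0}" by (auto simp: zero_set_def)
  then show ?thesis
    using card_common_zeros[of "poly_eval f"] poly_eval_qform[OF assms]
    by (simp add: qform_zero[of "poly_eval f"] qform_polar(2)[of "poly_eval f"])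
qed

text \<open>The dictionary at the extremal value: 2q + 2 points are (q - 1)(2q + 2) + 1 = 2q^2 - 1
  vectors.\<close>

lemma card_zero_set_extremal:
  assumes "f \<in> quadratic_forms"
  shows "card {x. Q x = 0 \<and> poly_eval f x = 0} + 1 = 2 * CARD('a)\<^sup>2 \<longleftrightarrow>
      card (zero_set f \<inter> quadric) = 2 * CARD('a) + 2"
    and "card {x. Q x = 0 \<and> poly_eval f x = 0} + 1 < 2 * CARD('a)\<^sup>2 \<longleftrightarrow>
      card (zero_set f \<inter> quadric) < 2 * CARD('a) + 2"
proof -
  obtain n where n: "CARD('a) = Suc (Suc n)"
    using card_field_ge_2[where 'a = 'a] by (metis add_2_eq_Suc le_Suc_ex)
  have 1: "card {x. Q x = 0 \<and> poly_eval f x = 0} + 1 = Suc n * card (zero_set f \<inter> quadric) + 2"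
    using card_zero_set_common[OF assms] by (simp add: n)
  have 2: "2 * CARD('a)\<^sup>2 = Suc n * (2 * CARD('a) + 2) + 2"
    by (simp add: n power2_eq_square)
  show "card {x. Q x = 0 \<and> poly_eval f x = 0} + 1 = 2 * CARD('a)\<^sup>2 \<longleftrightarrow>
      card (zero_set f \<inter> quadric) = 2 * CARD('a) + 2"
    unfolding 1 2 by (simp only: add_right_cancel mult_cancel1) simp
  show "card {x. Q x = 0 \<and> poly_eval f x = 0} + 1 < 2 * CARD('a)\<^sup>2 \<longleftrightarrow>
      card (zero_set f \<inter> quadric) < 2 * CARD('a) + 2"
    unfolding 1 2 by (simp only: add_less_cancel_right mult_less_cancel1) simp
qed

lemma ex_nonzero_weight:
  assumes "weight quadric (codeword quadric f) \<noteq> 0"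
  obtains z where "Q z = 0" "poly_eval f z \<noteq> 0"
proof -
  have "{x \<in> quadric. codeword quadric f x \<noteq> 0} \<noteq> {}" using assms by (auto simp: weight_def)
  then show thesis using that by (auto simp: codeword_def)
qed

lemma card_zero_set_le:
  assumes f: "f \<in> quadratic_forms" and w: "weight quadric (codeword quadric f) \<noteq> 0"
  shows "card (zero_set f \<inter> quadric) \<le> 2 * CARD('a) + 2"
proof -
  obtain z where "Q z = 0" "poly_eval f z \<noteq> 0" using ex_nonzero_weight[OF w] .
  then show ?thesis
    by (rule common_zeros_bound[OF poly_eval_qform[OF f]])
       (use card_zero_set_extremal[OF f] in auto)
qed

lemma min_weight: "min_weight quadric + (2 * CARD('a) + 2) = CARD('a)\<^sup>2 + 1"
proof -
  obtain \<phi> \<psi> where lin: "functional \<phi>" "functional \<psi>"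
    and size: "section_size \<phi> = CARD('a)\<^sup>2" "section_size \<psi> = CARD('a)\<^sup>2"
    and zero: "\<And>x. \<phi> x = 0 \<Longrightarrow> \<psi> x = 0 \<Longrightarrow> Q x = 0 \<Longrightarrow> x = 0"
    using ex_extremal_pair by blast
  have "{x. Q x = 0 \<and> \<phi> x = 0 \<and> \<psi> x = 0} = {0}"
    using zero functional_zero[OF lin(1)] functional_zero[OF lin(2)] qform_zero[OF Q] by auto
  then have count: "card {x. Q x = 0 \<and> \<phi> x * \<psi> x = 0} + 1 = 2 * CARD('a)\<^sup>2"
    using product_zeros[OF lin] size by simp
  obtain f where f: "f \<in> quadratic_forms" "poly_eval f = (\<lambda>x. \<phi> x * \<psi> x)"
    using qform_poly[OF qform_prod[OF lin]] by blast
  have "card (zero_set f \<inter> quadric) = 2 * CARD('a) + 2"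
    using card_zero_set_extremal(1)[OF f(1)] count unfolding f(2) by blast
  then have wf: "weight quadric (codeword quadric f) + (2 * CARD('a) + 2) = CARD('a)\<^sup>2 + 1"
    using weight_codeword[of f] by simp
  \<comment> \<open>Here q \<ge> 3 ensures q^2 - 2q - 1 > 0, so this weight is admissible as a
    minimum.\<close>
  moreover have "3 * CARD('a) \<le> CARD('a)\<^sup>2"
    using card_ge_3 by (simp add: power2_eq_square)
  ultimately have "weight quadric (codeword quadric f) \<noteq> 0" using card_ge_3 by linarith
  moreover have "weight quadric (codeword quadric f) \<le> weight quadric (codeword quadric h)"
    if "h \<in> quadratic_forms" "weight quadric (codeword quadric h) \<noteq> 0" for h
    using card_zero_set_le[OF that] weight_codeword[of h] wf by linarith
  ultimately have "min_weight quadric = weight quadric (codeword quadric f)"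
    unfolding min_weight_def functional_code_def using f(1) by (intro Least_equality) auto
  then show ?thesis using wf by simp
qed

lemma min_weight_iff:
  "weight quadric (codeword quadric f) = min_weight quadric \<longleftrightarrow> card (zero_set f \<inter> quadric) = 2 * CARD('a) + 2"
  using min_weight weight_codeword[of f] by linarith

text \<open>The representative of the codeword is exchanged: the product of linear forms that equals
  f + tQ takes the same values on the quadric as \<open>f\<close>, whatever type \<open>f\<close>
  itself has.\<close>

lemma min_weight_two_planes:
  assumes f: "f \<in> quadratic_forms" and w: "weight quadric (codeword quadric f) = min_weight quadric"
  obtains g where "g \<in> quadratic_forms" "g \<noteq> 0" "codeword quadric g = codeword quadric f"
    "two_planes_type quadric (zero_set g)"
proof -
  have "3 * CARD('a) \<le> CARD('a)\<^sup>2"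
    using card_ge_3 by (simp add: power2_eq_square)
  then have "weight quadric (codeword quadric f) \<noteq> 0" using min_weight w card_ge_3 by linarith
  then obtain z where z: "Q z = 0" "poly_eval f z \<noteq> 0" using ex_nonzero_weight by blast
  have extremal: "card {x. Q x = 0 \<and> poly_eval f x = 0} + 1 = 2 * CARD('a)\<^sup>2"
    using w min_weight_iff card_zero_set_extremal(1)[OF f] by blast
  obtain t \<phi> \<psi> where lin: "functional \<phi>" "functional \<psi>"
    and fac: "\<And>x. poly_eval f x + t * Q x = \<phi> x * \<psi> x"
    and size: "section_size \<phi> = CARD('a)\<^sup>2" "section_size \<psi> = CARD('a)\<^sup>2"
    and zero: "\<And>x. \<phi> x = 0 \<Longrightarrow> \<psi> x = 0 \<Longrightarrow> Q x = 0 \<Longrightarrow> x = 0"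
  proof (rule common_zeros_bound[OF poly_eval_qform[OF f] z])
    assume "card {x. Q x = 0 \<and> poly_eval f x = 0} + 1 < 2 * CARD('a)\<^sup>2"
    then show thesis using extremal by simp
  qed (rule that)
  obtain g where g: "g \<in> quadratic_forms" "poly_eval g = (\<lambda>x. \<phi> x * \<psi> x)"
    using qform_poly[OF qform_prod[OF lin]] by blast
  have eq: "poly_eval g x = poly_eval f x" if "Q x = 0" for x
    using fac[of x] that by (simp add: g(2))
  have nz: "\<phi> z \<noteq> 0" "\<psi> z \<noteq> 0" using eq[OF z(1)] z(2) by (auto simp: g(2))
  let ?P1 = "proj_points \<inter> {x. \<phi> x = 0}" and ?P2 = "proj_points \<inter> {x. \<psi> x = 0}"
  have planes: "non_tangent_plane quadric ?P1" "non_tangent_plane quadric ?P2"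
    using section_non_tangent[OF lin(1) nz(1) size(1)] section_non_tangent[OF lin(2) nz(2) size(2)] by blast+
  have "0 \<notin> (proj_points :: ('a ^ 4) set)" by (simp add: proj_points_def)
  then have skew: "?P1 \<inter> ?P2 \<inter> quadric = {}" using zero by blast
  \<comment> \<open>If they were equal, skewness would leave the plane without points of the
    quadric, whereas it has q + 1.\<close>
  have "?P1 \<noteq> ?P2"
  proof
    assume "?P1 = ?P2"
    then have "?P1 \<inter> quadric = {}" using skew by blast
    then show False using non_tangent_section[OF planes(1)] by simp
  qed
  moreover have "zero_set g = ?P1 \<union> ?P2" by (auto simp: zero_set_def g(2))
  ultimately have "two_planes_type quadric (zero_set g)"
    unfolding two_planes_type_def skew_to_def
    by (intro exI[of _ ?P1] exI[of _ ?P2] conjI planes skew)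
  moreover have "codeword quadric g = codeword quadric f"
    by (auto simp: codeword_def restrict_def eq)
  moreover have "g \<noteq> 0" using eq[OF z(1)] z(2) by auto
  ultimately show thesis using that g(1) by blast
qed

end

theorem theorem6p9:
  fixes X :: "('a::{field, finite} ^ 4) set" and w :: "'a ^ 4 \<Rightarrow> 'a"
  assumes "CARD('a) \<ge> 3" and "elliptic_quadric X" and "w \<in> functional_code X"
  shows "weight X w = min_weight X \<longleftrightarrow>
    (\<exists>f\<in>quadratic_forms. f \<noteq> 0 \<and> w = codeword X f \<and>
       (two_planes_type X (zero_set f) \<or> cone_type X (zero_set f) \<or> hyperbolic_type X (zero_set f)))"
proof -
  obtain f0 where f0: "f0 \<in> quadratic_forms" "form_rank f0 = 4" "X = zero_set f0"
    and card: "card X = CARD('a)\<^sup>2 + 1"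
    using assms(2) by (auto simp: elliptic_quadric_def quadric_of_rank_def)
  let ?Q = "poly_eval f0"
  have Q: "qform ?Q" by (rule poly_eval_qform[OF f0(1)])
  have X: "X = {x \<in> proj_points. ?Q x = 0}" by (simp add: f0(3) zero_set_def)
  interpret elliptic_form ?Q
  proof
    show "qform ?Q" by (rule Q)
    obtain n where n: "CARD('a) = Suc n" using assms(1) by (metis Suc_le_D numeral_3_eq_3)
    have "card {x. ?Q x = 0} = (CARD('a) - 1) * card X + 1"
      using card_zero_set_cone[of "{x. ?Q x = 0}"]
      by (simp add: X Int_def qform_zero[OF Q] qform_polar(2)[OF Q])
    then show "card {x. ?Q x = 0} + CARD('a)\<^sup>2 = CARD('a) ^ 3 + CARD('a)"
      unfolding card by (simp add: n power2_eq_square power3_eq_cube)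
    \<comment> \<open>A singular vector orthogonal to everything is a radical vector, which would
      push the rank below 4. Orthogonality alone would not do in characteristic 2;
      \<open>?Q p = 0\<close> is used too.\<close>
    show "\<exists>x. polar ?Q p x \<noteq> 0" if "p \<noteq> 0" "?Q p = 0" for p
    proof (rule ccontr)
      assume *: "\<not> ?thesis"
      have "?Q (x + p) = ?Q x" for x
        using qform_polar(3)[OF Q, of x 1 p] * that(2) polar_sym[of ?Q x p] by simp
      then show False using radical_form_rank_less[OF f0(1) that(1)] f0(2) by simp
    qed
    show "3 \<le> CARD('a)" by (rule assms(1))
  qed
  obtain h where h: "h \<in> quadratic_forms" "w = codeword X h"
    using assms(3) by (auto simp: functional_code_def)
  show ?thesis
  proof
    assume "weight X w = min_weight X"
    then obtain g where "g \<in> quadratic_forms" "g \<noteq> 0" "codeword X g = codeword X h"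
      "two_planes_type X (zero_set g)"
      using min_weight_two_planes[OF h(1)] unfolding h(2) X by blast
    then show "\<exists>f\<in>quadratic_forms. f \<noteq> 0 \<and> w = codeword X f \<and>
       (two_planes_type X (zero_set f) \<or> cone_type X (zero_set f) \<or> hyperbolic_type X (zero_set f))"
      using h(2) by metis
  next
    assume "\<exists>f\<in>quadratic_forms. f \<noteq> 0 \<and> w = codeword X f \<and>
       (two_planes_type X (zero_set f) \<or> cone_type X (zero_set f) \<or> hyperbolic_type X (zero_set f))"
    then obtain f where f: "w = codeword X f" and
      type: "two_planes_type X (zero_set f) \<or> cone_type X (zero_set f) \<or> hyperbolic_type X (zero_set f)"
      by blast
    have "card (zero_set f \<inter> X) = 2 * CARD('a) + 2"
      using type two_planes_type_card cone_type_card hyperbolic_type_card unfolding X by blast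
    then show "weight X w = min_weight X" using min_weight_iff[of f] unfolding f X by blast
  qed
qed

end
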